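(* Let $\mathbf p\in\mathcal V^{n,d}$. The map $R_{\mathbf p}:T_{\mathbf p}\mathcal V^{n,d}\to\mathcal V^{n,d}$, $\mathbf q\mapsto R_{\mathbf p}(\mathbf q)=\pi_{\theta(\mathbf p+\mathbf q)}(\mathbf p+\mathbf q)$, is a retraction operator on the Veronese manifold $\mathcal V^{n,d}$.
   Context: $\mathbb C[\mathbf x]_d$ is the space of homogeneous polynomials of degree $d$ in $\mathbf x=(x_1,\dots,x_n)$; $d>2$. Writing $\mathbf p=\sum_{|\alpha|=d}\binom d\alpha p_\alpha\mathbf x^\alpha$, $\mathbf q=\sum_{|\alpha|=d}\binom d\alpha q_\alpha\mathbf x^\alpha$, the apolar product is $\langle\mathbf p,\mathbf q\rangle_d=\sum_{|\alpha|=d}\binom d\alpha\bar p_\alpha q_\alpha$, and $\|\mathbf p\|_d=\sqrt{\langle\mathbf p,\mathbf p\rangle_d}$. Let $\psi:\mathbb C^n\to\mathbb C[\mathbf x]_d$, $\psi(v)=(v^t\mathbf x)^d$. The Veronese manifold is $\mathcal V^{n,d}=\psi(\mathbb C^n\setminus\{0\})$, regarded as a real smooth submanifold of $\mathbb C[\mathbf x]_d$, with tangent space $T_{\mathbf p}\mathcal V^{n,d}=\{(u^t\mathbf x)(v^t\mathbf x)^{d-1}:u\in\mathbb C^n\}$ at $\mathbf p=(v^t\mathbf x)^d$. For $v\in\mathbb C^n\setminus\{0\}$, $\pi_v(\mathbf q)=\frac{\langle\psi(v),\mathbf q\rangle_d}{\|\psi(v)\|_d^2}\psi(v)$ for $\mathbf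 q\in\mathbb C[\mathbf x]_d$ (one has $\pi_{\lambda v}=\pi_v$ for $\lambda\in\mathbb C\setminus\{0\}$). The Hankel (Catalecticant) matrix of degree $(1,d-1)$ of $\mathbf p$ is $H_{\mathbf p}^{1,d-1}=(\langle\mathbf x^{\alpha+\beta},\mathbf p\rangle_d)_{|\alpha|=1,|\beta|=d-1}=(p_{\alpha+\beta})_{|\alpha|=1,|\beta|=d-1}$, with rows indexed by the $n$ monomials $x_1,\dots,x_n$ and columns by the monomials of degree $d-1$. $\theta(\mathbf p)\in\mathbb C^n$ is the first left singular vector of $H_{\mathbf p}^{1,d-1}$ (a left singular vector for the largest singular value; its choice up to scalar is irrelevant in $\pi_{\theta(\cdot)}$ when the largest singular value is simple). A retraction on a manifold $\mathcal M$ at $y\in\mathcal M$ is a map $R_y:T_y\mathcal M\to\mathcal M$ such that: (1) $R_y(0_y)=y$; (2) there is an open neighborhood $\mathcal U_y\subset T_y\mathcal M$ of $0_y$ such that the restriction of $R_y$ to $\mathcal U_y$ is well-defined and smooth; (3) $DR_y(0_y)=\mathrm{id}_{T_y\mathcal M}$. The map $R_{\mathbf p}$ is only required to be well-defined (with values in $\mathcal V^{n,d}$) near $0_{\mathbf p}$, as in (2). *)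

theory Defs
  imports "HOL-Analysis.Analysis" "HOL-Analysis.Finite_Function_Topology"
begin

section \<open>Homogeneous polynomials and the apolar product\<close>

text \<open>
  \<open>\<complex>[x\<^sub>i | i \<in> 'n]\<close> is the monoid algebra of the exponent vectors \<open>'n \<Rightarrow>\<^sub>0 nat\<close>: an exponent vector
  \<open>\<alpha>\<close> is mapped to the coefficient of \<open>x\<^sup>\<alpha>\<close>, and multiplication is that of the library. The
  library also makes this type a real normed vector space (with the sum of the absolute values of
  the coefficients as norm). On the finite-dimensional space \<open>forms d\<close> all norms are equivalent, so
  this one gives the same open sets, derivatives and smooth maps as the apolar norm.
\<close>

type_synonym 'n cpoly = "('n \<Rightarrow>\<^sub>0 nat) \<Rightarrow>\<^sub>0 complex"

definition mdeg :: "('n::finite \<Rightarrow>\<^sub>0 nat) \<Rightarrow> nat" where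
  "mdeg \<alpha> = (\<Sum>i\<in>UNIV. poly_mapping.lookup \<alpha> i)"

definition forms :: "nat \<Rightarrow> ('n::finite) cpoly set" where
  "forms d = {p. \<forall>\<alpha>\<in>Poly_Mapping.keys p. mdeg \<alpha> = d}"

definition multinomial :: "nat \<Rightarrow> ('n::finite \<Rightarrow>\<^sub>0 nat) \<Rightarrow> complex" where
  "multinomial d \<alpha> = fact d / (\<Prod>i\<in>UNIV. fact (poly_mapping.lookup \<alpha> i))"

text \<open>The number \<open>p\<^sub>\<alpha>\<close> in \<open>p = (\<Sum>|\<alpha>| = d. multinomial d \<alpha> * p\<^sub>\<alpha> * x\<^sup>\<alpha>)\<close>.\<close>

definition ncoeff :: "nat \<Rightarrow> ('n::finite) cpoly \<Rightarrow> ('n \<Rightarrow>\<^sub>0 nat) \<Rightarrow> complex" where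
  "ncoeff d p \<alpha> = poly_mapping.lookup p \<alpha> / multinomial d \<alpha>"

definition apolar :: "nat \<Rightarrow> ('n::finite) cpoly \<Rightarrow> 'n cpoly \<Rightarrow> complex" where
  "apolar d p q = (\<Sum>\<alpha> | mdeg \<alpha> = d. multinomial d \<alpha> * cnj (ncoeff d p \<alpha>) * ncoeff d q \<alpha>)"

definition apolar_norm :: "nat \<Rightarrow> ('n::finite) cpoly \<Rightarrow> real" where
  "apolar_norm d p = sqrt (Re (apolar d p p))"

lemma finite_mdeg_eq: "finite {\<alpha> :: 'n::finite \<Rightarrow>\<^sub>0 nat. mdeg \<alpha> = d}"
proof -
  have le: "poly_mapping.lookup \<alpha> i \<le> mdeg \<alpha>" for \<alpha> :: "'n \<Rightarrow>\<^sub>0 nat" and i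
    unfolding mdeg_def by (rule member_le_sum) simp_all
  have "poly_mapping.lookup ` {\<alpha> :: 'n \<Rightarrow>\<^sub>0 nat. mdeg \<alpha> = d} \<subseteq> Pi\<^sub>E UNIV (\<lambda>_. {..d})"
  proof (rule image_subsetI, rule PiE_I)
    fix \<alpha> :: "'n \<Rightarrow>\<^sub>0 nat" and i :: 'n
    assume "\<alpha> \<in> {\<alpha>. mdeg \<alpha> = d}"
    then show "poly_mapping.lookup \<alpha> i \<in> {..d}"
      using le[of \<alpha> i] by simp
  qed simp
  then have "finite (poly_mapping.lookup ` {\<alpha> :: 'n \<Rightarrow>\<^sub>0 nat. mdeg \<alpha> = d})"
    by (rule finite_subset) (rule finite_PiE, simp_all)
  then show ?thesis
    by (rule finite_imageD) (simp add: inj_on_def poly_mapping.lookup_inject)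
qed

section \<open>The Veronese manifold\<close>

definition linear_form :: "complex ^ 'n \<Rightarrow> ('n::finite) cpoly" where
  "linear_form v = (\<Sum>i\<in>UNIV. Poly_Mapping.single (Poly_Mapping.single i 1) (v $ i))"

definition veronese_map :: "nat \<Rightarrow> complex ^ 'n \<Rightarrow> ('n::finite) cpoly" where
  "veronese_map d v = linear_form v ^ d"

definition veronese :: "nat \<Rightarrow> ('n::finite) cpoly set" where
  "veronese d = veronese_map d ` (UNIV - {0})"

text \<open>
  The vector \<open>v\<close> with \<open>veronese_map d v = p\<close> is unique up to a \<open>d\<close>-th root of unity, which can be
  absorbed into \<open>u\<close>.
\<close>

definition veronese_tangent :: "nat \<Rightarrow> ('n::finite) cpoly \<Rightarrow> 'n cpoly set" where
  "veronese_tangent d p =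
     {linear_form u * linear_form v ^ (d - 1) | u v. v \<noteq> 0 \<and> veronese_map d v = p}"

text \<open>\<open>Poly_Mapping.single 0 c\<close> is the constant polynomial \<open>c\<close>.\<close>

definition veronese_proj :: "nat \<Rightarrow> complex ^ 'n \<Rightarrow> ('n::finite) cpoly \<Rightarrow> 'n cpoly" where
  "veronese_proj d v q =
     Poly_Mapping.single 0
       (apolar d (veronese_map d v) q / complex_of_real ((apolar_norm d (veronese_map d v))\<^sup>2))
     * veronese_map d v"

section \<open>Hankel matrix and singular vectors\<close>

text \<open>The row of the monomial \<open>x\<^sub>i\<close> is indexed by \<open>i\<close>; the columns are the \<open>\<beta>\<close> with \<open>|\<beta>| = d - 1\<close>.\<close>

definition hankel :: "nat \<Rightarrow> ('n::finite) cpoly \<Rightarrow> 'n \<Rightarrow> ('n \<Rightarrow>\<^sub>0 nat) \<Rightarrow> complex" where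
  "hankel d p i \<beta> = apolar d (Poly_Mapping.single (Poly_Mapping.single i 1 + \<beta>) 1) p"

lemma apolar_monomial:
  fixes p :: "('n::finite) cpoly"
  assumes "mdeg \<gamma> = d"
  shows "apolar d (Poly_Mapping.single \<gamma> 1) p = ncoeff d p \<gamma>"
proof -
  have nz: "multinomial d \<gamma> \<noteq> 0" and cnj: "cnj (multinomial d \<gamma>) = multinomial d \<gamma>"
    by (simp_all add: multinomial_def)
  have "apolar d (Poly_Mapping.single \<gamma> 1) p =
      (\<Sum>\<alpha> | mdeg \<alpha> = d. if \<gamma> = \<alpha> then ncoeff d p \<alpha> else 0)"
    unfolding apolar_def
  proof (rule sum.cong)
    fix \<alpha> :: "'n \<Rightarrow>\<^sub>0 nat"
    show "multinomial d \<alpha> * cnj (ncoeff d (Poly_Mapping.single \<gamma> 1) \<alpha>) * ncoeff d p \<alpha>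
        = (if \<gamma> = \<alpha> then ncoeff d p \<alpha> else 0)"
      by (cases "\<gamma> = \<alpha>") (use nz cnj in \<open>simp_all add: ncoeff_def lookup_single\<close>)
  qed simp
  also have "\<dots> = ncoeff d p \<gamma>"
    using assms by (simp add: finite_mdeg_eq)
  finally show ?thesis .
qed

lemma hankel_eq_ncoeff:
  fixes p :: "('n::finite) cpoly"
  assumes "d > 0" "mdeg \<beta> = d - 1"
  shows "hankel d p i \<beta> = ncoeff d p (Poly_Mapping.single i 1 + \<beta>)"
proof -
  have "mdeg (Poly_Mapping.single i 1 + \<beta>) = 1 + mdeg \<beta>"
    by (simp add: mdeg_def lookup_add sum.distrib lookup_single when_def)
  with assms show ?thesis
    unfolding hankel_def by (intro apolar_monomial) linarith
qed

text \<open>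
  \<open>singular_triple J A \<sigma> u w\<close>: for the complex matrix \<open>A\<close> with columns indexed by \<open>J\<close>, the number
  \<open>\<sigma>\<close> is a singular value with unit left and right singular vectors \<open>u\<close> and \<open>w\<close>, that is
  \<open>A w = \<sigma> u\<close> and \<open>A\<^sup>* u = \<sigma> w\<close> with \<open>A\<^sup>*\<close> the conjugate transpose.
\<close>

definition singular_triple ::
  "'c set \<Rightarrow> ('n::finite \<Rightarrow> 'c \<Rightarrow> complex) \<Rightarrow> real \<Rightarrow> complex ^ 'n \<Rightarrow> ('c \<Rightarrow> complex) \<Rightarrow> bool" where
  "singular_triple J A \<sigma> u w \<longleftrightarrow>
     0 \<le> \<sigma> \<and> norm u = 1 \<and> (\<Sum>j\<in>J. (cmod (w j))\<^sup>2) = 1 \<and>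
     (\<forall>i. (\<Sum>j\<in>J. A i j * w j) = complex_of_real \<sigma> * u $ i) \<and>
     (\<forall>j\<in>J. (\<Sum>i\<in>UNIV. cnj (A i j) * u $ i) = complex_of_real \<sigma> * w j)"

definition first_left_singular_vector ::
  "'c set \<Rightarrow> ('n::finite \<Rightarrow> 'c \<Rightarrow> complex) \<Rightarrow> complex ^ 'n \<Rightarrow> bool" where
  "first_left_singular_vector J A u \<longleftrightarrow>
     (\<exists>\<sigma> w. singular_triple J A \<sigma> u w \<and>
        (\<forall>\<sigma>' u' w'. singular_triple J A \<sigma>' u' w' \<longrightarrow> \<sigma>' \<le> \<sigma>))"

section \<open>Retractions\<close>

text \<open>
  \<open>C_k_on k T U f\<close>: \<open>f\<close> is of class \<open>C\<^sup>k\<close> on the relatively open subset \<open>U\<close> of the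
  finite-dimensional real subspace \<open>T\<close>, i.e. its iterated derivatives in directions of \<open>T\<close> up to
  order \<open>k\<close> exist and are continuous. Only directions in \<open>T\<close> matter: the values of a derivative
  within \<open>U\<close> are not determined on other vectors.
\<close>

primrec C_k_on ::
  "nat \<Rightarrow> 'a::real_normed_vector set \<Rightarrow> 'a set \<Rightarrow> ('a \<Rightarrow> 'b::real_normed_vector) \<Rightarrow> bool" where
  "C_k_on 0 T U f \<longleftrightarrow> continuous_on U f"
| "C_k_on (Suc k) T U f \<longleftrightarrow>
     (\<exists>f'. (\<forall>x\<in>U. (f has_derivative f' x) (at x within U)) \<and>
           (\<forall>h\<in>T. C_k_on k T U (\<lambda>x. f' x h)))"

definition smooth_on ::
  "'a::real_normed_vector set \<Rightarrow> 'a set \<Rightarrow> ('a \<Rightarrow> 'b::real_normed_vector) \<Rightarrow> bool" where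
  "smooth_on T U f \<longleftrightarrow> (\<forall>k. C_k_on k T U f)"

text \<open>
  Here \<open>M\<close> is an embedded real submanifold of the ambient space and \<open>T\<close> its tangent space at \<open>y\<close>.
  Smoothness of an \<open>M\<close>-valued map is then smoothness as a map into the ambient space. Outside the
  neighbourhood \<open>U\<close> the values of \<open>R\<close> are arbitrary.
\<close>

definition retraction_at ::
  "'a::real_normed_vector set \<Rightarrow> 'a set \<Rightarrow> 'a \<Rightarrow> ('a \<Rightarrow> 'a) \<Rightarrow> bool" where
  "retraction_at M T y R \<longleftrightarrow>
     R 0 = y \<and>
     (\<exists>U. openin (top_of_set T) U \<and> 0 \<in> U \<and> R ` U \<subseteq> M \<and> smooth_on T U R) \<and>
     (R has_derivative (\<lambda>q. q)) (at 0 within T)"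

end

theory Submission
  imports Defs
begin


text \<open>
  A form \<open>f\<close> of degree \<open>d\<close> has a Hankel matrix \<open>H f\<close>, and its left singular vectors are the
  eigenvectors of the Hermitian matrix \<open>H f (H f)\<^sup>*\<close>. The theorem rests on what happens at a power of
  a linear form. For \<open>f = (w\<^sup>t x)\<^sup>d\<close> the Hankel matrix is \<open>(w\<^sub>i w\<^sup>\<beta>)\<close>, of rank one with column space
  spanned by \<open>w\<close>; so the first left singular vector is a multiple of \<open>w\<close>, and the projection onto
  the line of \<open>\<psi>(w)\<close> returns \<open>f\<close> itself (\<open>rank_one_approximation_fixes_veronese\<close>). The map
  \<open>\<Pi> f = \<pi>\<^bsub>\<theta>(f)\<^esub>(f)\<close> is therefore the identity on the Veronese manifold. Once \<open>\<Pi>\<close> is known to be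
  smooth on the forms near \<open>p\<close>, the three axioms follow: \<open>\<Pi> p = p\<close>; the values of \<open>\<Pi>\<close> near \<open>p\<close> are
  non-zero multiples of powers of linear forms, and a non-zero complex multiple of such a power is
  again one; and \<open>D\<Pi>(p)\<close> fixes the velocity at \<open>0\<close> of each curve \<open>t \<mapsto> \<psi>(w + (t/d) u)\<close>, which is
  the general tangent vector at \<open>p = \<psi>(w)\<close>.

  For smoothness, fix \<open>p = \<psi>(v)\<close> and let \<open>B\<close> be \<open>H H\<^sup>*\<close> at the form \<open>p + q\<close>, scaled so that at
  \<open>q = 0\<close> it is the projection \<open>z \<mapsto> \<ell>(z) v\<close> with \<open>\<ell>(v) = 1\<close>. The projection onto a line depends only
  on the line, so \<open>\<theta>\<close> may be replaced by its multiple \<open>y\<close> with \<open>\<ell>(y) = 1\<close>. The first singular vector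
  maximises the quadratic form of \<open>B\<close> (\<open>first_left_singular_vector_dominates\<close>), which forces \<open>y\<close> to
  tend to \<open>v\<close> as \<open>q\<close> tends to \<open>0\<close> (\<open>dominant_eigenvector_near_rank_one\<close>).

  Write \<open>y\<close> and \<open>y'\<close> for the normalised eigenvectors of \<open>B\<close> and \<open>B'\<close>. Subtracting the two eigenvalue
  equations gives an exact linear system for \<open>y - y'\<close> whose right-hand side is linear in \<open>B - B'\<close> and
  whose matrix is close to minus the identity. Cramer's rule solves it
  (\<open>eigenvector_difference\<close>): \<open>y - y'\<close> is a sum of entries of \<open>B - B'\<close> times coefficients that are
  rational in \<open>B'\<close>, \<open>y\<close> and \<open>y'\<close>. Hence \<open>y\<close> is continuous, then differentiable, and its derivative is
  a rational expression in the coefficients of the form and in \<open>y\<close> itself. So the functions that are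
  rational in these quantities and their conjugates form an algebra closed under directional
  derivatives, and all its members are smooth (\<open>C_k_on_if_closed_under_derivatives\<close>,
  \<open>smooth_top_eigenvector\<close>). The coefficients of \<open>\<Pi>(p + q)\<close> belong to it.
\<close>

section \<open>Algebras of functions closed under differentiation\<close>

text \<open>
  The functions that are rational in the generators and their complex conjugates, where the
  denominators have no zeros on \<open>U\<close>. Conjugation is included because \<open>H H\<^sup>*\<close> and the apolar product
  are not holomorphic.
\<close>

inductive_set func_algebra :: "'a set \<Rightarrow> ('a \<Rightarrow> complex) set \<Rightarrow> ('a \<Rightarrow> complex) set"
  for U :: "'a set" and G :: "('a \<Rightarrow> complex) set" where
  gen: "g \<in> G \<Longrightarrow> g \<in> func_algebra U G"
| const: "(\<lambda>x. c) \<in> func_algebra U G"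
| add: "f \<in> func_algebra U G \<Longrightarrow> g \<in> func_algebra U G \<Longrightarrow> (\<lambda>x. f x + g x) \<in> func_algebra U G"
| mult: "f \<in> func_algebra U G \<Longrightarrow> g \<in> func_algebra U G \<Longrightarrow> (\<lambda>x. f x * g x) \<in> func_algebra U G"
| cnj: "f \<in> func_algebra U G \<Longrightarrow> (\<lambda>x. cnj (f x)) \<in> func_algebra U G"
| inverse: "f \<in> func_algebra U G \<Longrightarrow> (\<And>x. x \<in> U \<Longrightarrow> f x \<noteq> 0)
    \<Longrightarrow> (\<lambda>x. inverse (f x)) \<in> func_algebra U G"

lemma func_algebra_uminus:
  assumes "f \<in> func_algebra U G" shows "(\<lambda>x. - f x) \<in> func_algebra U G"
  using func_algebra.mult[OF func_algebra.const[of "-1"] assms] by simp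

lemma func_algebra_diff:
  assumes "f \<in> func_algebra U G" "g \<in> func_algebra U G"
  shows "(\<lambda>x. f x - g x) \<in> func_algebra U G"
  using func_algebra.add[OF assms(1) func_algebra_uminus[OF assms(2)]] by simp

lemma func_algebra_divide:
  assumes "f \<in> func_algebra U G" "g \<in> func_algebra U G" "\<And>x. x \<in> U \<Longrightarrow> g x \<noteq> 0"
  shows "(\<lambda>x. f x / g x) \<in> func_algebra U G"
  using func_algebra.mult[OF assms(1) func_algebra.inverse[OF assms(2,3)]]
  by (simp add: divide_inverse)

lemma func_algebra_sum:
  assumes "\<And>i. i \<in> I \<Longrightarrow> f i \<in> func_algebra U G"
  shows "(\<lambda>x. \<Sum>i\<in>I. f i x) \<in> func_algebra U G"
  using assms by (induction I rule: infinite_finite_induct)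
    (auto intro: func_algebra.const func_algebra.add)

lemma func_algebra_prod:
  assumes "\<And>i. i \<in> I \<Longrightarrow> f i \<in> func_algebra U G"
  shows "(\<lambda>x. \<Prod>i\<in>I. f i x) \<in> func_algebra U G"
  using assms by (induction I rule: infinite_finite_induct)
    (auto intro: func_algebra.const func_algebra.mult)

lemma func_algebra_power:
  assumes "f \<in> func_algebra U G"
  shows "(\<lambda>x. f x ^ m) \<in> func_algebra U G"
  by (induction m) (auto intro: func_algebra.const func_algebra.mult assms)

lemma func_algebra_det:
  fixes L :: "'a \<Rightarrow> complex^'n^'n"
  assumes "\<And>i j. (\<lambda>x. L x $ i $ j) \<in> func_algebra U G"
  shows "(\<lambda>x. det (L x)) \<in> func_algebra U G"
  unfolding det_def
  by (intro func_algebra_sum func_algebra.mult func_algebra.const func_algebra_prod assms)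

lemmas func_algebra_intros =
  func_algebra.const func_algebra.add func_algebra.mult func_algebra.cnj func_algebra_uminus
  func_algebra_diff func_algebra_divide func_algebra_sum func_algebra_prod func_algebra_power

text \<open>
  The set \<open>S\<close> is meant to be an algebra containing \<open>f\<close>: when each of its members
  differentiates into it, derivatives can be taken again and again.
\<close>

definition differentiates_into ::
  "'a::real_normed_vector set \<Rightarrow> 'a set \<Rightarrow> ('a \<Rightarrow> complex) set \<Rightarrow> ('a \<Rightarrow> complex) \<Rightarrow> bool" where
  "differentiates_into T U S f \<longleftrightarrow>
     (\<exists>f'. (\<forall>x\<in>U. (f has_derivative f' x) (at x within U)) \<and> (\<forall>h\<in>T. (\<lambda>x. f' x h) \<in> S))"

text \<open>
  The rules of differentiation express the derivative of a sum, product, conjugate or inverse by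
  the given functions and their derivatives, so it is enough to look at the generators. The second
  algebra, over \<open>G'\<close>, allows for generators whose derivatives involve further functions.
\<close>

lemma func_algebra_differentiates:
  assumes gen: "\<And>g. g \<in> G \<Longrightarrow> g \<in> func_algebra U G' \<and> differentiates_into T U (func_algebra U G') g"
    and "f \<in> func_algebra U G"
  shows "f \<in> func_algebra U G' \<and> differentiates_into T U (func_algebra U G') f"
  using assms(2)
proof induction
  case (gen g)
  then show ?case by (rule assms(1))
next
  case (const c)
  have "differentiates_into T U (func_algebra U G') (\<lambda>x. c)"
    unfolding differentiates_into_def
    by (rule exI[of _ "\<lambda>x h. 0"]) (auto intro: func_algebra.const)
  then show ?case by (auto intro: func_algebra.const)
next
  case (add f g)
  then obtain f' g' where "\<forall>x\<in>U. (f has_derivative f' x) (at x within U)"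
      "\<forall>h\<in>T. (\<lambda>x. f' x h) \<in> func_algebra U G'"
      "\<forall>x\<in>U. (g has_derivative g' x) (at x within U)"
      "\<forall>h\<in>T. (\<lambda>x. g' x h) \<in> func_algebra U G'"
    unfolding differentiates_into_def by blast
  then have "differentiates_into T U (func_algebra U G') (\<lambda>x. f x + g x)"
    unfolding differentiates_into_def
    by (intro exI[of _ "\<lambda>x h. f' x h + g' x h"])
      (auto intro: func_algebra.add has_derivative_add)
  with add show ?case by (auto intro: func_algebra.add)
next
  case (mult f g)
  then obtain f' g' where "\<forall>x\<in>U. (f has_derivative f' x) (at x within U)"
      "\<forall>h\<in>T. (\<lambda>x. f' x h) \<in> func_algebra U G'"
      "\<forall>x\<in>U. (g has_derivative g' x) (at x within U)"
      "\<forall>h\<in>T. (\<lambda>x. g' x h) \<in> func_algebra U G'"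
    unfolding differentiates_into_def by blast
  with mult have "differentiates_into T U (func_algebra U G') (\<lambda>x. f x * g x)"
    unfolding differentiates_into_def
    by (intro exI[of _ "\<lambda>x h. f x * g' x h + f' x h * g x"])
      (auto intro!: func_algebra.add func_algebra.mult has_derivative_mult)
  with mult show ?case by (auto intro: func_algebra.mult)
next
  case (cnj f)
  then obtain f' where "\<forall>x\<in>U. (f has_derivative f' x) (at x within U)"
      "\<forall>h\<in>T. (\<lambda>x. f' x h) \<in> func_algebra U G'"
    unfolding differentiates_into_def by blast
  then have "differentiates_into T U (func_algebra U G') (\<lambda>x. cnj (f x))"
    unfolding differentiates_into_def
    by (intro exI[of _ "\<lambda>x h. cnj (f' x h)"])
      (auto intro: func_algebra.cnj bounded_linear.has_derivative[OF bounded_linear_cnj])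
  with cnj show ?case by (auto intro: func_algebra.cnj)
next
  case (inverse f)
  then obtain f' where "\<forall>x\<in>U. (f has_derivative f' x) (at x within U)"
      "\<forall>h\<in>T. (\<lambda>x. f' x h) \<in> func_algebra U G'"
    unfolding differentiates_into_def by blast
  with inverse have "differentiates_into T U (func_algebra U G') (\<lambda>x. inverse (f x))"
    unfolding differentiates_into_def
    by (intro exI[of _ "\<lambda>x h. - (inverse (f x) * f' x h * inverse (f x))"])
      (auto intro!: func_algebra.mult func_algebra_uminus func_algebra.inverse
        Deriv.has_derivative_inverse)
  with inverse show ?case by (auto intro: func_algebra.inverse)
qed

text \<open>
  Smoothness from first order information alone: each directional derivative is again a member of
  \<open>S\<close>, hence differentiable, and induction on the order applies.
\<close>

lemma C_k_on_if_closed_under_derivatives: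
  assumes "\<And>s. s \<in> S \<Longrightarrow> differentiates_into T U S s" and "f \<in> S"
  shows "C_k_on k T U f"
  using \<open>f \<in> S\<close>
proof (induction k arbitrary: f)
  case 0
  then obtain f' where "\<forall>x\<in>U. (f has_derivative f' x) (at x within U)"
    using assms(1) unfolding differentiates_into_def by blast
  then show ?case
    by (auto simp: continuous_on_eq_continuous_within intro: has_derivative_continuous)
next
  case (Suc k)
  then obtain f' where "\<forall>x\<in>U. (f has_derivative f' x) (at x within U)"
    "\<forall>h\<in>T. (\<lambda>x. f' x h) \<in> S"
    using assms(1) unfolding differentiates_into_def by blast
  with Suc.IH show ?case by auto
qed

section \<open>Functions of class \<open>C\<^sup>k\<close> on a subset of a subspace\<close>

lemma C_k_on_cong:
  assumes "\<And>x. x \<in> U \<Longrightarrow> f x = g x" and "C_k_on k T U f"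
  shows "C_k_on k T U g"
proof (cases k)
  case 0
  with assms show ?thesis using continuous_on_cong[of U U f g] by simp
next
  case (Suc k')
  with assms(2) obtain f' where "\<forall>x\<in>U. (f has_derivative f' x) (at x within U)"
    "\<forall>h\<in>T. C_k_on k' T U (\<lambda>x. f' x h)" by auto
  moreover from this have "\<forall>x\<in>U. (g has_derivative f' x) (at x within U)"
    using assms(1) by (auto intro!: has_derivative_transform[of _ U g f])
  ultimately show ?thesis using Suc by auto
qed

lemma C_k_on_subset:
  assumes "C_k_on k T U f" "T' \<subseteq> T" "U' \<subseteq> U"
  shows "C_k_on k T' U' f"
  using assms(1)
proof (induction k arbitrary: f)
  case 0
  with assms(3) show ?case by (auto intro: continuous_on_subset)
next
  case (Suc k)
  then obtain f' where "\<forall>x\<in>U. (f has_derivative f' x) (at x within U)"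
    "\<forall>h\<in>T. C_k_on k T U (\<lambda>x. f' x h)" by auto
  have "\<forall>x\<in>U'. (f has_derivative f' x) (at x within U')"
    using \<open>\<forall>x\<in>U. _\<close> assms(3) by (blast intro: has_derivative_subset)
  moreover have "\<forall>h\<in>T'. C_k_on k T' U' (\<lambda>x. f' x h)"
    using \<open>\<forall>h\<in>T. _\<close> assms(2) Suc.IH by blast
  ultimately show ?case by auto
qed

text \<open>
  This passes from the scalar coefficients of a map to the map itself.
\<close>

lemma C_k_on_sum_bounded_linear:
  fixes s :: "'i \<Rightarrow> 'a::real_normed_vector \<Rightarrow> 'b::real_normed_vector"
    and B :: "'i \<Rightarrow> 'b \<Rightarrow> 'c::real_normed_vector"
  assumes "\<And>i. i \<in> I \<Longrightarrow> bounded_linear (B i)" "\<And>i. i \<in> I \<Longrightarrow> C_k_on k T U (s i)"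
  shows "C_k_on k T U (\<lambda>x. \<Sum>i\<in>I. B i (s i x))"
  using assms(2)
proof (induction k arbitrary: s)
  case 0
  then show ?case
    by simp (intro continuous_on_sum bounded_linear.continuous_on[OF assms(1)]; simp)
next
  case (Suc k)
  then have "\<forall>i\<in>I. \<exists>f'. (\<forall>x\<in>U. (s i has_derivative f' x) (at x within U)) \<and>
      (\<forall>h\<in>T. C_k_on k T U (\<lambda>x. f' x h))" by simp
  then obtain s' where s': "\<forall>i\<in>I. (\<forall>x\<in>U. (s i has_derivative s' i x) (at x within U)) \<and>
      (\<forall>h\<in>T. C_k_on k T U (\<lambda>x. s' i x h))" by metis
  have "\<forall>x\<in>U. ((\<lambda>x. \<Sum>i\<in>I. B i (s i x)) has_derivative (\<lambda>h. \<Sum>i\<in>I. B i (s' i x h))) (at x within U)"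
  proof
    fix x assume "x \<in> U"
    then show "((\<lambda>x. \<Sum>i\<in>I. B i (s i x)) has_derivative (\<lambda>h. \<Sum>i\<in>I. B i (s' i x h))) (at x within U)"
      using s' by (intro has_derivative_sum bounded_linear.has_derivative[OF assms(1)]) auto
  qed
  moreover have "\<forall>h\<in>T. C_k_on k T U (\<lambda>x. \<Sum>i\<in>I. B i (s' i x h))"
    using s' by (auto intro!: Suc.IH)
  ultimately show ?case by auto
qed

section \<open>Perturbation of a normalised eigenvector\<close>

text \<open>
  Caratheodory's form of differentiability: a factor multiplying an increment need only be
  continuous at the base point. This is how an exact difference formula, with coefficients that
  depend on the moving point, yields a derivative.
\<close>

lemma has_derivative_increment_times_continuous:
  fixes b g :: "'a::real_normed_vector \<Rightarrow> complex"
  assumes b: "(b has_derivative b') (at a within S)" and g: "(g \<longlongrightarrow> g a) (at a within S)"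
  shows "((\<lambda>x. (b x - b a) * g x) has_derivative (\<lambda>h. b' h * g a)) (at a within S)"
  unfolding has_derivative_within
proof
  have bl: "bounded_linear b'" using b by (rule has_derivative_bounded_linear)
  show "bounded_linear (\<lambda>h. b' h * g a)"
    by (rule bounded_linear_mult_const[OF bl])
  obtain K where K: "\<And>h. norm (b' h) \<le> norm h * K"
    using bounded_linear.bounded[OF bl] by blast
  have 1: "((\<lambda>y. (1 / norm (y - a)) *\<^sub>R (b y - (b a + b' (y - a))) * g y) \<longlongrightarrow> 0 * g a) (at a within S)"
    using b g unfolding has_derivative_within by (intro tendsto_mult) auto
  have 2: "((\<lambda>y. (1 / norm (y - a)) *\<^sub>R b' (y - a) * (g y - g a)) \<longlongrightarrow> 0) (at a within S)"
  proof (rule Lim_null_comparison)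
    show "\<forall>\<^sub>F y in at a within S. norm ((1 / norm (y - a)) *\<^sub>R b' (y - a) * (g y - g a)) \<le> \<bar>K\<bar> * norm (g y - g a)"
    proof (rule always_eventually, rule allI)
      fix y
      have "norm (b' (y - a)) \<le> norm (y - a) * \<bar>K\<bar>"
        by (rule order_trans[OF K]) (simp add: mult_left_mono)
      then have "norm ((1 / norm (y - a)) *\<^sub>R b' (y - a)) \<le> \<bar>K\<bar>"
        by (cases "y = a") (auto simp: field_simps)
      then show "norm ((1 / norm (y - a)) *\<^sub>R b' (y - a) * (g y - g a)) \<le> \<bar>K\<bar> * norm (g y - g a)"
        unfolding norm_mult by (rule mult_right_mono) simp
    qed
    have "((\<lambda>y. \<bar>K\<bar> * norm (g y - g a)) \<longlongrightarrow> \<bar>K\<bar> * norm (g a - g a)) (at a within S)"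
      by (intro tendsto_intros g)
    then show "((\<lambda>y. \<bar>K\<bar> * norm (g y - g a)) \<longlongrightarrow> 0) (at a within S)" by simp
  qed
  have "((\<lambda>y. (1 / norm (y - a)) *\<^sub>R (b y - (b a + b' (y - a))) * g y
      + (1 / norm (y - a)) *\<^sub>R b' (y - a) * (g y - g a)) \<longlongrightarrow> 0) (at a within S)"
    using tendsto_add[OF 1 2] by simp
  then show "((\<lambda>y. (1 / norm (y - a)) *\<^sub>R ((b y - b a) * g y -
      ((b a - b a) * g a + b' (y - a) * g a))) \<longlongrightarrow> 0) (at a within S)"
    
    by (rule Lim_transform_eventually)
      (auto simp: algebra_simps scaleR_conv_of_real diff_divide_distrib add_divide_distrib)
qed

text \<open>
  An entry of the inverse matrix in the form given by Cramer's rule, which exhibits it as a rational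
  function of the entries of \<open>L\<close>.
\<close>

definition inv_entry :: "'a::field^'n^'n \<Rightarrow> 'n \<Rightarrow> 'n \<Rightarrow> 'a" where
  "inv_entry L k i =
     det (\<chi> a j. if j = k then (if a = i then 1 else 0) else L $ a $ j) / det L"

lemma solution_eq_inv_entry:
  fixes L :: "'a::field^'n^'n"
  assumes "det L \<noteq> 0" "L *v z = r"
  shows "z $ k = (\<Sum>i\<in>UNIV. inv_entry L k i * r $ i)"
proof -
  define E where "E i = (\<chi> k. inv_entry L k i)" for i
  have E: "L *v E i = axis i 1" for i
  proof -
    have "E i = (\<chi> k. det (\<chi> a j. if j = k then axis i 1 $ a else L $ a $ j) / det L)"
      unfolding E_def inv_entry_def axis_def by (simp cong: if_cong)
    then show ?thesis using cramer[OF assms(1)] by blast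
  qed
  have "L *v (\<Sum>i\<in>UNIV. r $ i *s E i) = (\<Sum>i\<in>UNIV. r $ i *s (L *v E i))"
    by (simp add: matrix_vector_mult_def vec_eq_iff sum_component sum_distrib_left mult_ac)
      (subst sum.swap, simp)
  also have "\<dots> = r" unfolding E by (rule basis_expansion)
  finally have "L *v (\<Sum>i\<in>UNIV. r $ i *s E i) = r" .
  then have "(\<Sum>i\<in>UNIV. r $ i *s E i) = z"
    using assms(2) unfolding cramer[OF assms(1)] by simp
  then have "z $ k = (\<Sum>i\<in>UNIV. r $ i *s E i) $ k" by simp
  then show ?thesis
    by (simp add: E_def sum_component mult.commute)
qed

definition covector :: "('n::finite \<Rightarrow> complex) \<Rightarrow> complex^'n \<Rightarrow> complex" where
  "covector a z = (\<Sum>i\<in>UNIV. a i * z $ i)"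

lemma covector_diff: "covector a (y - z) = covector a y - covector a z"
  by (simp add: covector_def right_diff_distrib sum_subtractf)

lemma covector_scale: "covector a (c *s z) = c * covector a z"
  by (simp add: covector_def sum_distrib_left mult_ac)

text \<open>
  For \<open>y = y'\<close> this is the matrix of the derivative of \<open>y \<mapsto> B y - \<ell>(B y) y\<close>, whose zeros with
  \<open>\<ell>(y) = 1\<close> are the normalised eigenvectors of \<open>B\<close>; here \<open>\<ell>\<close> is the functional \<open>covector a\<close>. Keeping two
  vectors apart makes it describe finite differences exactly.
\<close>

definition eig_matrix ::
  "('n::finite \<Rightarrow> complex) \<Rightarrow> complex^'n^'n \<Rightarrow> complex^'n \<Rightarrow> complex^'n \<Rightarrow> complex^'n^'n" where
  "eig_matrix a B y y' = (\<chi> i j. B $ i $ j - (if i = j then covector a (B *v y') else 0)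
     - y $ i * (\<Sum>k\<in>UNIV. a k * B $ k $ j))"

lemma eig_matrix_mult:
  "eig_matrix a B y y' *v z = B *v z - covector a (B *v y') *s z - covector a (B *v z) *s y"
proof -
  have "covector a (B *v z) = (\<Sum>j\<in>UNIV. (\<Sum>k\<in>UNIV. a k * B $ k $ j) * z $ j)"
    unfolding covector_def matrix_vector_mult_def
    by (simp add: sum_distrib_left sum_distrib_right mult_ac) (rule sum.swap)
  then have S: "(\<Sum>j\<in>UNIV. y $ i * (\<Sum>k\<in>UNIV. a k * B $ k $ j) * z $ j) = covector a (B *v z) * y $ i" for i
    by (simp only: sum_distrib_left[symmetric] mult.assoc) (simp only: mult.commute)
  have D: "(\<Sum>j\<in>UNIV. (if i = j then c else 0) * z $ j) = c * z $ i" for i c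
  proof -
    have "(\<Sum>j\<in>UNIV. (if i = j then c else 0) * z $ j) = (\<Sum>j\<in>UNIV. if i = j then c * z $ j else 0)"
      by (rule sum.cong) auto
    then show ?thesis by simp
  qed
  have "(eig_matrix a B y y' *v z) $ i = (\<Sum>j\<in>UNIV. B $ i $ j * z $ j)
      - (\<Sum>j\<in>UNIV. (if i = j then covector a (B *v y') else 0) * z $ j)
      - (\<Sum>j\<in>UNIV. y $ i * (\<Sum>k\<in>UNIV. a k * B $ k $ j) * z $ j)" for i
    unfolding eig_matrix_def
    by (subst (1) matrix_vector_mult_def) (simp only: vec_lambda_beta left_diff_distrib sum_subtractf)
  then show ?thesis
    unfolding S D by (simp add: vec_eq_iff matrix_vector_mul_component matrix_vector_mult_def[of B z])
qed

text \<open>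
  Subtract \<open>B' y' = \<ell>(B' y') y'\<close> from \<open>B y = \<ell>(B y) y\<close> and collect the terms that contain \<open>y - y'\<close>.
  No term of second order in \<open>y - y'\<close> remains, because it is absorbed into the matrix on the left.
\<close>

lemma eig_matrix_mult_difference:
  assumes "B *v y = covector a (B *v y) *s y" "B' *v y' = covector a (B' *v y') *s y'"
  shows "eig_matrix a B' y y' *v (y - y') = covector a ((B - B') *v y) *s y - (B - B') *v y"
proof -
  define c c' where "c = covector a (B *v y)" and "c' = covector a (B' *v y')"
  have "(B *v y) $ i = c * y $ i" "(B' *v y') $ i = c' * y' $ i" for i
    using assms by (simp_all add: c_def c'_def vec_eq_iff)
  then show ?thesis
    unfolding eig_matrix_mult matrix_vector_mult_diff_distrib matrix_vector_mult_diff_rdistrib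
      covector_diff c_def[symmetric] c'_def[symmetric]
    by (simp add: vec_eq_iff algebra_simps)
qed

text \<open>
  The factor of \<open>B\<^sub>j\<^sub>l - B'\<^sub>j\<^sub>l\<close> in the \<open>k\<close>-th component of the solution \<open>y - y'\<close> of the linear system
  of \<open>eig_matrix_mult_difference\<close>.
\<close>

definition eig_coeff ::
  "('n::finite \<Rightarrow> complex) \<Rightarrow> complex^'n^'n \<Rightarrow> complex^'n \<Rightarrow> complex^'n \<Rightarrow> 'n \<Rightarrow> 'n \<Rightarrow> 'n \<Rightarrow> complex" where
  "eig_coeff a B y y' k j l =
     y $ l * (a j * (\<Sum>i\<in>UNIV. inv_entry (eig_matrix a B y y') k i * y $ i)
              - inv_entry (eig_matrix a B y y') k j)"

lemma eigenvector_difference: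
  assumes "B *v y = covector a (B *v y) *s y" "B' *v y' = covector a (B' *v y') *s y'"
    and "det (eig_matrix a B' y y') \<noteq> 0"
  shows "y $ k - y' $ k = (\<Sum>j\<in>UNIV. \<Sum>l\<in>UNIV. (B $ j $ l - B' $ j $ l) * eig_coeff a B' y y' k j l)"
proof -
  define K where "K = inv_entry (eig_matrix a B' y y') k"
  define D where "D j = ((B - B') *v y) $ j" for j
  have "y $ k - y' $ k = (\<Sum>i\<in>UNIV. K i * (covector a ((B - B') *v y) * y $ i - D i))"
    using solution_eq_inv_entry[OF assms(3) eig_matrix_mult_difference[OF assms(1,2)], of k]
    by (simp add: K_def D_def)
  also have "\<dots> = covector a ((B - B') *v y) * (\<Sum>i\<in>UNIV. K i * y $ i) - (\<Sum>i\<in>UNIV. K i * D i)"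
    by (simp add: right_diff_distrib sum_subtractf sum_distrib_left mult_ac)
  also have "\<dots> = (\<Sum>j\<in>UNIV. D j * (a j * (\<Sum>i\<in>UNIV. K i * y $ i) - K j))"
    by (simp add: covector_def D_def[symmetric] right_diff_distrib sum_subtractf sum_distrib_right mult_ac)
  also have "\<dots> = (\<Sum>j\<in>UNIV. \<Sum>l\<in>UNIV. (B $ j $ l - B' $ j $ l) * eig_coeff a B' y y' k j l)"
  proof (rule sum.cong)
    fix j
    define E where "E = a j * (\<Sum>i\<in>UNIV. K i * y $ i) - K j"
    show "D j * (a j * (\<Sum>i\<in>UNIV. K i * y $ i) - K j) =
        (\<Sum>l\<in>UNIV. (B $ j $ l - B' $ j $ l) * eig_coeff a B' y y' k j l)"
      unfolding eig_coeff_def K_def[symmetric] E_def[symmetric]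
      by (simp add: D_def matrix_vector_mult_def sum_distrib_left mult_ac)
  qed simp
  finally show ?thesis .
qed

lemma tendsto_det:
  fixes L :: "'a \<Rightarrow> complex^'n^'n"
  assumes "\<And>i j. ((\<lambda>x. L x $ i $ j) \<longlongrightarrow> L0 $ i $ j) F"
  shows "((\<lambda>x. det (L x)) \<longlongrightarrow> det L0) F"
  unfolding det_def by (intro tendsto_intros assms)

lemma tendsto_inv_entry:
  fixes L :: "'a \<Rightarrow> complex^'n^'n"
  assumes "\<And>i j. ((\<lambda>x. L x $ i $ j) \<longlongrightarrow> L0 $ i $ j) F" "det L0 \<noteq> 0"
  shows "((\<lambda>x. inv_entry (L x) k i) \<longlongrightarrow> inv_entry L0 k i) F"
  unfolding inv_entry_def
  by (intro tendsto_divide tendsto_det assms) (auto intro: assms)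

lemma tendsto_eig_matrix:
  assumes "\<And>i j. ((\<lambda>x. B x $ i $ j) \<longlongrightarrow> B0 $ i $ j) F"
    "\<And>i. ((\<lambda>x. y x $ i) \<longlongrightarrow> y0 $ i) F" "\<And>i. ((\<lambda>x. y' x $ i) \<longlongrightarrow> y0' $ i) F"
  shows "((\<lambda>x. eig_matrix a (B x) (y x) (y' x) $ i $ j) \<longlongrightarrow> eig_matrix a B0 y0 y0' $ i $ j) F"
proof -
  have "((\<lambda>x. if i = j then covector a (B x *v y' x) else 0) \<longlongrightarrow>
      (if i = j then covector a (B0 *v y0') else 0)) F"
    by (cases "i = j") (simp_all add: covector_def matrix_vector_mult_def,
        intro tendsto_sum tendsto_mult tendsto_const assms)
  then show ?thesis
    unfolding eig_matrix_def vec_lambda_beta by (intro tendsto_diff tendsto_sum tendsto_mult tendsto_const assms)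
qed

lemma tendsto_eig_coeff:
  assumes "\<And>i j. ((\<lambda>x. B x $ i $ j) \<longlongrightarrow> B0 $ i $ j) F"
    "\<And>i. ((\<lambda>x. y x $ i) \<longlongrightarrow> y0 $ i) F" "\<And>i. ((\<lambda>x. y' x $ i) \<longlongrightarrow> y0' $ i) F"
    and "det (eig_matrix a B0 y0 y0') \<noteq> 0"
  shows "((\<lambda>x. eig_coeff a (B x) (y x) (y' x) k j l) \<longlongrightarrow> eig_coeff a B0 y0 y0' k j l) F"
proof -
  have "((\<lambda>x. eig_matrix a (B x) (y x) (y' x) $ i $ j) \<longlongrightarrow> eig_matrix a B0 y0 y0' $ i $ j) F" for i j
    using assms(1-3) by (rule tendsto_eig_matrix)
  then have K: "((\<lambda>x. inv_entry (eig_matrix a (B x) (y x) (y' x)) k i) \<longlongrightarrow>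
      inv_entry (eig_matrix a B0 y0 y0') k i) F" for i
    using assms(4) by (rule tendsto_inv_entry)
  show ?thesis
    unfolding eig_coeff_def
    by (intro tendsto_mult tendsto_diff tendsto_sum tendsto_const assms(2) K)
qed

text \<open>
  At the base point the linear system is as well conditioned as possible, which makes it solvable
  for all pairs of nearby points.
\<close>

lemma eig_matrix_rank_one:
  assumes "\<And>i j. B $ i $ j = v $ i * a j" "covector a v = 1"
  shows "eig_matrix a B v v = - mat 1"
proof -
  have "(B *v v) $ i = v $ i * covector a v" for i
    by (simp add: matrix_vector_mult_def assms(1) covector_def sum_distrib_left mult_ac)
  then have Bv: "B *v v = v" by (simp add: vec_eq_iff assms(2))
  have "(\<Sum>k\<in>UNIV. a k * (v $ k * a j)) = covector a v * a j" for j
    unfolding covector_def sum_distrib_right by (simp add: mult_ac)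
  then have aB: "(\<Sum>k\<in>UNIV. a k * (v $ k * a j)) = a j" for j
    by (simp add: assms(2))
  have "eig_matrix a B v v $ i $ j = (- mat 1) $ i $ j" for i j
    by (simp add: eig_matrix_def mat_def Bv aB assms)
  then show ?thesis by (simp add: vec_eq_iff)
qed

text \<open>
  The coefficients are continuous functions of \<open>B'\<close>, \<open>y\<close>, \<open>y'\<close> where the determinant does not
  vanish, so they stay bounded as both points approach the base point. The bound is uniform in the
  pair of points, which is what the continuity of \<open>y\<close> away from the base point requires.
\<close>

lemma eventually_eig_matrix_regular:
  fixes B :: "'a \<Rightarrow> complex^'n^'n"
  assumes B: "\<And>i j. ((\<lambda>x. B x $ i $ j) \<longlongrightarrow> v $ i * a j) W"
    and y: "\<And>i. ((\<lambda>x. y x $ i) \<longlongrightarrow> v $ i) W"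
    and v: "covector a v = 1"
  obtains P C where "eventually P W"
    "\<And>x x'. P x \<Longrightarrow> P x' \<Longrightarrow> det (eig_matrix a (B x') (y x) (y x')) \<noteq> 0"
    "\<And>x x' k j l. P x \<Longrightarrow> P x' \<Longrightarrow> cmod (eig_coeff a (B x') (y x) (y x') k j l) \<le> C"
proof -
  define B0 :: "complex^'n^'n" where "B0 = (\<chi> i j. v $ i * a j)"
  have L0: "eig_matrix a B0 v v = - mat 1"
    by (rule eig_matrix_rank_one) (auto simp: B0_def v)
  have "det (- mat 1 :: complex^'n^'n) \<noteq> 0"
  proof -
    have "(\<Sum>k\<in>UNIV. (- mat 1 :: complex^'n^'n) $ i $ k * (- mat 1 :: complex^'n^'n) $ k $ j) =
        (\<Sum>k\<in>UNIV. if k = i then mat 1 $ i $ j else 0)" for i j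
      by (rule sum.cong) (auto simp: mat_def)
    then have "(- mat 1 :: complex^'n^'n) ** (- mat 1) = mat 1"
      by (simp add: matrix_matrix_mult_def vec_eq_iff)
    then show ?thesis
      unfolding invertible_det_nz[symmetric] invertible_def by blast
  qed
  then have nz: "det (eig_matrix a B0 v v) \<noteq> 0" by (simp add: L0)
  have fst: "filterlim fst W (W \<times>\<^sub>F W)" and snd: "filterlim snd W (W \<times>\<^sub>F W)"
    by (rule filterlim_fst, rule filterlim_snd)
  have lims: "((\<lambda>p. B (snd p) $ i $ j) \<longlongrightarrow> B0 $ i $ j) (W \<times>\<^sub>F W)"
    "((\<lambda>p. y (fst p) $ i) \<longlongrightarrow> v $ i) (W \<times>\<^sub>F W)"
    "((\<lambda>p. y (snd p) $ i) \<longlongrightarrow> v $ i) (W \<times>\<^sub>F W)" for i j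
    using filterlim_compose[OF B snd] filterlim_compose[OF y fst] filterlim_compose[OF y snd]
    by (auto simp: B0_def)
  have "((\<lambda>p. eig_matrix a (B (snd p)) (y (fst p)) (y (snd p)) $ i $ j) \<longlongrightarrow>
      eig_matrix a B0 v v $ i $ j) (W \<times>\<^sub>F W)" for i j
    using lims by (rule tendsto_eig_matrix)
  then have "((\<lambda>p. det (eig_matrix a (B (snd p)) (y (fst p)) (y (snd p)))) \<longlongrightarrow>
      det (eig_matrix a B0 v v)) (W \<times>\<^sub>F W)"
    by (rule tendsto_det)
  then have det: "\<forall>\<^sub>F p in W \<times>\<^sub>F W. det (eig_matrix a (B (snd p)) (y (fst p)) (y (snd p))) \<noteq> 0"
    using nz by (rule tendsto_imp_eventually_ne)
  \<comment> \<open>The sum over all indices is a convenient upper bound for the limits of all the coefficients.\<close>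
  define C where "C = (\<Sum>k\<in>UNIV. \<Sum>j\<in>UNIV. \<Sum>l\<in>UNIV. cmod (eig_coeff a B0 v v k j l)) + 1"
  have bound: "\<forall>\<^sub>F p in W \<times>\<^sub>F W. \<forall>k j l. cmod (eig_coeff a (B (snd p)) (y (fst p)) (y (snd p)) k j l) \<le> C"
  proof (intro eventually_all_finite)
    fix k j l
    have "cmod (eig_coeff a B0 v v k j l) \<le> (\<Sum>l\<in>UNIV. cmod (eig_coeff a B0 v v k j l))"
      by (rule member_le_sum) auto
    also have "\<dots> \<le> (\<Sum>j\<in>UNIV. \<Sum>l\<in>UNIV. cmod (eig_coeff a B0 v v k j l))"
      by (rule member_le_sum[where f = "\<lambda>j. \<Sum>l\<in>UNIV. cmod (eig_coeff a B0 v v k j l)"]) (auto intro!: sum_nonneg)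
    also have "\<dots> \<le> (\<Sum>k\<in>UNIV. \<Sum>j\<in>UNIV. \<Sum>l\<in>UNIV. cmod (eig_coeff a B0 v v k j l))"
      by (rule member_le_sum[where f = "\<lambda>k. \<Sum>j\<in>UNIV. \<Sum>l\<in>UNIV. cmod (eig_coeff a B0 v v k j l)"]) (auto intro!: sum_nonneg)
    finally have lt: "cmod (eig_coeff a B0 v v k j l) < C" by (simp add: C_def)
    have "((\<lambda>p. eig_coeff a (B (snd p)) (y (fst p)) (y (snd p)) k j l) \<longlongrightarrow>
        eig_coeff a B0 v v k j l) (W \<times>\<^sub>F W)"
      using lims nz by (rule tendsto_eig_coeff)
    from order_tendstoD(2)[OF tendsto_norm[OF this] lt]
    have "\<forall>\<^sub>F p in W \<times>\<^sub>F W. cmod (eig_coeff a (B (snd p)) (y (fst p)) (y (snd p)) k j l) < C" .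
    then show "\<forall>\<^sub>F p in W \<times>\<^sub>F W. cmod (eig_coeff a (B (snd p)) (y (fst p)) (y (snd p)) k j l) \<le> C"
      by (rule eventually_mono) simp
  qed
  from eventually_conj[OF det bound] obtain P where "eventually P W"
    "\<forall>x x'. P x \<longrightarrow> P x' \<longrightarrow> det (eig_matrix a (B x') (y x) (y x')) \<noteq> 0 \<and>
       (\<forall>k j l. cmod (eig_coeff a (B x') (y x) (y x') k j l) \<le> C)"
    unfolding eventually_prod_same by auto
  then show thesis by (intro that[of P C]) auto
qed

text \<open>
  By the difference formula, \<open>y\<close> moves at most by a constant times the change of \<open>B\<close>.
\<close>

lemma eigenvector_continuous_on:
  fixes B :: "'a::topological_space \<Rightarrow> complex^'n^'n"
  assumes eig: "\<And>x. x \<in> U \<Longrightarrow> B x *v y x = covector a (B x *v y x) *s y x"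
    and det: "\<And>x x'. x \<in> U \<Longrightarrow> x' \<in> U \<Longrightarrow> det (eig_matrix a (B x') (y x) (y x')) \<noteq> 0"
    and bound: "\<And>x x' k j l. x \<in> U \<Longrightarrow> x' \<in> U \<Longrightarrow> cmod (eig_coeff a (B x') (y x) (y x') k j l) \<le> C"
    and B: "\<And>j l. continuous_on U (\<lambda>x. B x $ j $ l)"
  shows "continuous_on U (\<lambda>x. y x $ k)"
  unfolding continuous_on_def
proof
  fix x' assume x': "x' \<in> U"
  have "((\<lambda>x. y x $ k - y x' $ k) \<longlongrightarrow> 0) (at x' within U)"
  proof (rule Lim_null_comparison)
    show "\<forall>\<^sub>F x in at x' within U. norm (y x $ k - y x' $ k)
        \<le> (\<Sum>j\<in>UNIV. \<Sum>l\<in>UNIV. norm (B x $ j $ l - B x' $ j $ l) * C)"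
      unfolding eventually_at_filter
    proof (rule always_eventually, intro allI impI)
      fix x assume "x \<in> U"
      then have "norm (y x $ k - y x' $ k) =
          norm (\<Sum>j\<in>UNIV. \<Sum>l\<in>UNIV. (B x $ j $ l - B x' $ j $ l) * eig_coeff a (B x') (y x) (y x') k j l)"
        using x' by (subst eigenvector_difference[OF eig eig det]) auto
      also have "\<dots> \<le> (\<Sum>j\<in>UNIV. \<Sum>l\<in>UNIV. norm (B x $ j $ l - B x' $ j $ l) * C)"
        using \<open>x \<in> U\<close> x'
        by (intro sum_norm_le) (auto simp: norm_mult intro!: mult_left_mono bound)
      finally show "norm (y x $ k - y x' $ k)
        \<le> (\<Sum>j\<in>UNIV. \<Sum>l\<in>UNIV. norm (B x $ j $ l - B x' $ j $ l) * C)" .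
    qed
    have "((\<lambda>x. \<Sum>j\<in>UNIV. \<Sum>l\<in>UNIV. norm (B x $ j $ l - B x' $ j $ l) * C) \<longlongrightarrow>
        (\<Sum>j\<in>(UNIV::'n set). \<Sum>l\<in>(UNIV::'n set). norm (B x' $ j $ l - B x' $ j $ l) * C)) (at x' within U)"
      using B x' unfolding continuous_on_def
      by (intro tendsto_sum tendsto_mult tendsto_norm tendsto_diff tendsto_const) auto
    then show "((\<lambda>x. \<Sum>j\<in>UNIV. \<Sum>l\<in>UNIV. norm (B x $ j $ l - B x' $ j $ l) * C) \<longlongrightarrow> 0) (at x' within U)"
      by simp
  qed
  then show "((\<lambda>x. y x $ k) \<longlongrightarrow> y x' $ k) (at x' within U)"
    by (subst Lim_null)
qed

text \<open>
  Each summand of the difference formula is an increment of an entry of \<open>B\<close> times a factor that is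
  continuous because \<open>y\<close> is.
\<close>

lemma eigenvector_has_derivative:
  fixes B :: "'a::real_normed_vector \<Rightarrow> complex^'n^'n"
  assumes eig: "\<And>x. x \<in> U \<Longrightarrow> B x *v y x = covector a (B x *v y x) *s y x"
    and det: "\<And>x x'. x \<in> U \<Longrightarrow> x' \<in> U \<Longrightarrow> det (eig_matrix a (B x') (y x) (y x')) \<noteq> 0"
    and y: "\<And>k. continuous_on U (\<lambda>x. y x $ k)"
    and B: "\<And>j l. ((\<lambda>x. B x $ j $ l) has_derivative b' j l) (at x' within U)"
    and x': "x' \<in> U"
  shows "((\<lambda>x. y x $ k) has_derivative
     (\<lambda>h. \<Sum>j\<in>UNIV. \<Sum>l\<in>UNIV. b' j l h * eig_coeff a (B x') (y x') (y x') k j l)) (at x' within U)"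
proof -
  have lim: "((\<lambda>x. eig_coeff a (B x') (y x) (y x') k j l) \<longlongrightarrow> eig_coeff a (B x') (y x') (y x') k j l)
      (at x' within U)" for j l
    using y x' det[OF x' x'] unfolding continuous_on_def
    by (intro tendsto_eig_coeff) auto
  have "((\<lambda>x. y x' $ k + (\<Sum>j\<in>UNIV. \<Sum>l\<in>UNIV.
        (B x $ j $ l - B x' $ j $ l) * eig_coeff a (B x') (y x) (y x') k j l)) has_derivative
     (\<lambda>h. 0 + (\<Sum>j\<in>UNIV. \<Sum>l\<in>UNIV. b' j l h * eig_coeff a (B x') (y x') (y x') k j l)))
     (at x' within U)"
    by (intro has_derivative_add has_derivative_const has_derivative_sum
        has_derivative_increment_times_continuous B lim)
  then have "((\<lambda>x. y x' $ k + (\<Sum>j\<in>UNIV. \<Sum>l\<in>UNIV.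
        (B x $ j $ l - B x' $ j $ l) * eig_coeff a (B x') (y x) (y x') k j l)) has_derivative
     (\<lambda>h. \<Sum>j\<in>UNIV. \<Sum>l\<in>UNIV. b' j l h * eig_coeff a (B x') (y x') (y x') k j l))
     (at x' within U)" by simp
  then show ?thesis
  proof (rule has_derivative_transform[OF x', rotated])
    fix x assume "x \<in> U"
    then show "y x $ k = y x' $ k + (\<Sum>j\<in>UNIV. \<Sum>l\<in>UNIV.
        (B x $ j $ l - B x' $ j $ l) * eig_coeff a (B x') (y x) (y x') k j l)"
      using eigenvector_difference[OF eig eig det, of x x' k] x' by (simp add: algebra_simps)
  qed
qed

lemma func_algebra_eig_coeff:
  fixes B :: "'a \<Rightarrow> complex^'n^'n"
  assumes B: "\<And>i j. (\<lambda>x. B x $ i $ j) \<in> func_algebra U G"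
    and y: "\<And>i. (\<lambda>x. y x $ i) \<in> func_algebra U G"
    and det: "\<And>x. x \<in> U \<Longrightarrow> det (eig_matrix a (B x) (y x) (y x)) \<noteq> 0"
  shows "(\<lambda>x. eig_coeff a (B x) (y x) (y x) k j l) \<in> func_algebra U G"
proof -
  have L: "(\<lambda>x. eig_matrix a (B x) (y x) (y x) $ i $ j) \<in> func_algebra U G" for i j
  proof -
    have "(\<lambda>x. if i = j then covector a (B x *v y x) else 0) \<in> func_algebra U G"
      by (cases "i = j")
        (auto simp: covector_def matrix_vector_mult_def intro!: func_algebra_intros B y)
    then show ?thesis
      unfolding eig_matrix_def by simp (intro func_algebra_intros B y)
  qed
  have "(\<lambda>x. inv_entry (eig_matrix a (B x) (y x) (y x)) k i) \<in> func_algebra U G" for k i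
    unfolding inv_entry_def
  proof (intro func_algebra_divide func_algebra_det det L)
    show "(\<lambda>x. (\<chi> aa j. if j = k then if aa = i then 1 else 0
        else eig_matrix a (B x) (y x) (y x) $ aa $ j) $ ia $ j) \<in> func_algebra U G" for ia j
      by (cases "j = k") (auto intro: func_algebra.const L)
  qed
  then show ?thesis
    unfolding eig_coeff_def by (intro func_algebra_intros y)
qed

text \<open>
  The derivative of \<open>y\<close> is rational in \<open>B\<close>, its derivative, and \<open>y\<close> itself, so adjoining the
  components of \<open>y\<close> to the generators keeps the algebra closed under differentiation.
\<close>

lemma eigenvector_differentiates_into:
  fixes B :: "'a::real_normed_vector \<Rightarrow> complex^'n^'n"
  assumes eig: "\<And>x. x \<in> U \<Longrightarrow> B x *v y x = covector a (B x *v y x) *s y x"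
    and det: "\<And>x x'. x \<in> U \<Longrightarrow> x' \<in> U \<Longrightarrow> det (eig_matrix a (B x') (y x) (y x')) \<noteq> 0"
    and bound: "\<And>x x' k j l. x \<in> U \<Longrightarrow> x' \<in> U \<Longrightarrow> cmod (eig_coeff a (B x') (y x) (y x') k j l) \<le> C"
    and B: "\<And>j l. (\<lambda>x. B x $ j $ l) \<in> func_algebra U G"
      "\<And>j l. differentiates_into T U (func_algebra U G) (\<lambda>x. B x $ j $ l)"
    and y: "\<And>i. (\<lambda>x. y x $ i) \<in> G"
  shows "differentiates_into T U (func_algebra U G) (\<lambda>x. y x $ k)"
proof -
  have "\<forall>j l. \<exists>f'. (\<forall>x\<in>U. ((\<lambda>x. B x $ j $ l) has_derivative f' x) (at x within U)) \<and>
      (\<forall>h\<in>T. (\<lambda>x. f' x h) \<in> func_algebra U G)"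
    using B(2) unfolding differentiates_into_def by blast
  then obtain b where b: "\<And>j l x. x \<in> U \<Longrightarrow> ((\<lambda>x. B x $ j $ l) has_derivative b j l x) (at x within U)"
    and bG: "\<And>j l h. h \<in> T \<Longrightarrow> (\<lambda>x. b j l x h) \<in> func_algebra U G"
    by metis
  have "continuous_on U (\<lambda>x. B x $ j $ l)" for j l
    unfolding continuous_on_eq_continuous_within using b has_derivative_continuous by blast
  then have "continuous_on U (\<lambda>x. y x $ k)" for k
    using eig det bound by (rule eigenvector_continuous_on[rotated -1])
  then have "\<forall>x\<in>U. ((\<lambda>x. y x $ k) has_derivative
      (\<lambda>h. \<Sum>j\<in>UNIV. \<Sum>l\<in>UNIV. b j l x h * eig_coeff a (B x) (y x) (y x) k j l)) (at x within U)"
    using eigenvector_has_derivative[OF eig det _ b] by blast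
  moreover have "(\<lambda>x. eig_coeff a (B x) (y x) (y x) k j l) \<in> func_algebra U G" for j l
    using B(1) y det by (intro func_algebra_eig_coeff) (auto intro: func_algebra.gen)
  then have "\<forall>h\<in>T. (\<lambda>x. \<Sum>j\<in>UNIV. \<Sum>l\<in>UNIV. b j l x h * eig_coeff a (B x) (y x) (y x) k j l) \<in> func_algebra U G"
    by (auto intro!: func_algebra_intros bG)
  ultimately show ?thesis
    unfolding differentiates_into_def
    by (intro exI[of _ "\<lambda>x h. \<Sum>j\<in>UNIV. \<Sum>l\<in>UNIV. b j l x h * eig_coeff a (B x) (y x) (y x) k j l"]) simp
qed

section \<open>The first left singular vector as a dominant eigenvector\<close>

definition gram_matrix :: "'c set \<Rightarrow> ('n::finite \<Rightarrow> 'c \<Rightarrow> complex) \<Rightarrow> complex^'n^'n" where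
  "gram_matrix J A = (\<chi> i j. \<Sum>\<beta>\<in>J. A i \<beta> * cnj (A j \<beta>))"

definition adjoint_apply :: "('n::finite \<Rightarrow> 'c \<Rightarrow> complex) \<Rightarrow> complex^'n \<Rightarrow> 'c \<Rightarrow> complex" where
  "adjoint_apply A z \<beta> = (\<Sum>i\<in>UNIV. cnj (A i \<beta>) * z $ i)"

lemma gram_matrix_mult: "(gram_matrix J A *v z) $ i = (\<Sum>\<beta>\<in>J. A i \<beta> * adjoint_apply A z \<beta>)"
proof -
  have "(gram_matrix J A *v z) $ i = (\<Sum>j\<in>UNIV. \<Sum>\<beta>\<in>J. A i \<beta> * (cnj (A j \<beta>) * z $ j))"
    by (simp add: matrix_vector_mult_def gram_matrix_def sum_distrib_right mult.assoc)
  also have "\<dots> = (\<Sum>\<beta>\<in>J. \<Sum>j\<in>UNIV. A i \<beta> * (cnj (A j \<beta>) * z $ j))"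
    by (rule sum.swap)
  finally show ?thesis by (simp add: adjoint_apply_def sum_distrib_left)
qed

lemma inner_mult_complex: "inner (a * s) w = inner s (cnj a * w)" for a s w :: complex
  by (simp add: inner_complex_def algebra_simps)

text \<open>
  The real part of \<open>\<langle>A A\<^sup>* z, w\<rangle> = \<langle>A\<^sup>* z, A\<^sup>* w\<rangle>\<close>. The maximum principle for \<open>A A\<^sup>*\<close> can be phrased
  with real parts because \<open>\<langle>A A\<^sup>* z, z\<rangle>\<close> is real.
\<close>

lemma inner_gram_matrix:
  "inner (gram_matrix J A *v z) w = (\<Sum>\<beta>\<in>J. inner (adjoint_apply A z \<beta>) (adjoint_apply A w \<beta>))"
proof -
  have "inner (gram_matrix J A *v z) w = (\<Sum>i\<in>UNIV. \<Sum>\<beta>\<in>J. inner (A i \<beta> * adjoint_apply A z \<beta>) (w $ i))"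
    by (simp add: inner_vec_def gram_matrix_mult inner_sum_left)
  also have "\<dots> = (\<Sum>\<beta>\<in>J. \<Sum>i\<in>UNIV. inner (adjoint_apply A z \<beta>) (cnj (A i \<beta>) * w $ i))"
    unfolding inner_mult_complex by (rule sum.swap)
  finally show ?thesis by (simp add: adjoint_apply_def inner_sum_right)
qed

lemma gram_matrix_self_adjoint:
  "inner (gram_matrix J A *v z) w = inner z (gram_matrix J A *v w)"
  unfolding inner_commute[of z "gram_matrix J A *v w"] inner_gram_matrix
  by (simp add: inner_commute)

lemma matrix_vector_mult_add_scaleR:
  fixes B :: "complex^'n^'n"
  shows "B *v (z + t *\<^sub>R w) = B *v z + t *\<^sub>R (B *v w)"
  by (simp add: matrix_vector_mult_def vec_eq_iff algebra_simps sum.distrib scaleR_sum_right)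

text \<open>
  A quadratic that is nonnegative everywhere and vanishes at \<open>0\<close> has no linear term.
\<close>

lemma nonneg_quadratic_imp_linear_coeff_zero:
  fixes n Q :: real
  assumes "\<And>t. 0 \<le> t\<^sup>2 * Q - 2 * t * n" "0 \<le> n"
  shows "n = 0"
proof (rule ccontr)
  assume "n \<noteq> 0"
  with assms(2) have n: "n > 0" by simp
  define s where "s = \<bar>Q\<bar> + 1"
  have s: "s > 0" "Q \<le> s" by (simp_all add: s_def)
  have "0 \<le> (n / s)\<^sup>2 * Q - 2 * (n / s) * n" by (rule assms(1))
  also have "\<dots> = n\<^sup>2 / s * (Q / s - 2)"
    using s(1) by (simp add: field_simps power2_eq_square)
  also have "\<dots> < 0"
  proof (rule mult_pos_neg)
    show "0 < n\<^sup>2 / s" using n s by simp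
    have "Q / s \<le> 1" using s by simp
    then show "Q / s - 2 < 0" by simp
  qed
  finally show False by simp
qed

text \<open>
  A maximiser of the quadratic form on the unit sphere is an eigenvector: the form
  \<open>m |z|\<^sup>2 - \<langle>A A\<^sup>* z, z\<rangle>\<close> is positive semidefinite and vanishes at the maximiser \<open>z0\<close>, so its first
  variation there, in the direction of the residual \<open>b\<close>, is zero.
\<close>

lemma gram_matrix_top_eigenvector:
  obtains m and z0 :: "complex^'n::finite" where "norm z0 = 1"
    "gram_matrix J A *v z0 = complex_of_real m *s z0"
    "\<And>z. inner (gram_matrix J A *v z) z \<le> m * (norm z)\<^sup>2"
proof -
  let ?M = "gram_matrix J A"
  have comp: "continuous_on (sphere (0::complex^'n) 1) (\<lambda>z. z $ j)" for j
    by (rule continuous_on_component[OF continuous_on_id])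
  have "continuous_on (sphere (0::complex^'n) 1)
      (\<lambda>z. \<Sum>i\<in>UNIV. inner (\<Sum>j\<in>UNIV. ?M $ i $ j * z $ j) (z $ i))"
    by (rule continuous_on_sum, rule continuous_on_inner, rule continuous_on_sum,
      rule continuous_on_mult[OF continuous_on_const comp], rule comp)
  then have "continuous_on (sphere (0::complex^'n) 1) (\<lambda>z. inner (?M *v z) z)"
    by (simp add: inner_vec_def matrix_vector_mult_def)
  moreover have "sphere (0::complex^'n) 1 \<noteq> {}"
    by (auto simp: sphere_eq_empty)
  ultimately obtain z0 :: "complex^'n" where "z0 \<in> sphere 0 1"
    and "\<forall>z\<in>sphere 0 1. inner (?M *v z) z \<le> inner (?M *v z0) z0"
    using continuous_attains_sup[OF compact_sphere] by blast
  then have z0: "norm z0 = 1"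
    and max: "\<And>z. norm z = 1 \<Longrightarrow> inner (?M *v z) z \<le> inner (?M *v z0) z0"
    by auto
  define m where "m = inner (?M *v z0) z0"
  have le: "inner (?M *v z) z \<le> m * (norm z)\<^sup>2" for z
  proof (cases "z = 0")
    case False
    have z: "z = 0 + norm z *\<^sub>R sgn z" by (simp add: sgn_div_norm False)
    have "inner (?M *v z) z = (norm z)\<^sup>2 * inner (?M *v sgn z) (sgn z)"
      by (subst (1 2) z, subst matrix_vector_mult_add_scaleR) (simp add: power2_eq_square)
    also have "\<dots> \<le> (norm z)\<^sup>2 * m"
      unfolding m_def by (rule mult_left_mono[OF max]) (simp_all add: norm_sgn False)
    finally show ?thesis by (simp add: mult.commute)
  qed simp
  define b where "b = ?M *v z0 - m *\<^sub>R z0"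
  have "(norm b)\<^sup>2 = 0"
  proof (rule nonneg_quadratic_imp_linear_coeff_zero)
    fix t :: real
    have 1: "(norm (z0 + t *\<^sub>R b))\<^sup>2 = 1 + 2 * t * inner z0 b + t\<^sup>2 * (norm b)\<^sup>2"
      using z0 unfolding power2_norm_eq_inner
      by (simp add: norm_eq_1 inner_add_left inner_add_right inner_commute power2_eq_square algebra_simps)
    have 2: "inner (?M *v (z0 + t *\<^sub>R b)) (z0 + t *\<^sub>R b)
        = m + 2 * t * inner (?M *v z0) b + t\<^sup>2 * inner (?M *v b) b"
      using gram_matrix_self_adjoint[of J A b z0] unfolding matrix_vector_mult_add_scaleR m_def
      by (simp add: inner_add_left inner_add_right inner_commute power2_eq_square algebra_simps)
    have 3: "(norm b)\<^sup>2 = inner (?M *v z0) b - m * inner z0 b"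
      unfolding power2_norm_eq_inner by (subst (1) b_def) (simp add: inner_diff_left)
    show "0 \<le> t\<^sup>2 * (m * (norm b)\<^sup>2 - inner (?M *v b) b) - 2 * t * (norm b)\<^sup>2"
      using le[of "z0 + t *\<^sub>R b"] unfolding 1 2 by (subst (2) 3) (simp add: algebra_simps)
  qed simp
  then have "?M *v z0 = complex_of_real m *s z0"
    unfolding b_def by (simp add: vec_eq_iff scaleR_conv_of_real[where 'a = complex])
  with z0 le show thesis by (intro that)
qed

text \<open>
  The quantification in \<open>first_left_singular_vector\<close> ranges over singular triples only. To compare
  with arbitrary vectors, the maximal eigenvalue \<open>m\<close> of \<open>A A\<^sup>*\<close> has to be realised by a singular
  triple; for \<open>m > 0\<close> this is \<open>(\<surd>m, z0, A\<^sup>* z0 / \<surd>m)\<close>.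
\<close>

lemma first_left_singular_vector_dominates:
  assumes "first_left_singular_vector J A u"
  obtains \<mu> where "norm u = 1" "gram_matrix J A *v u = complex_of_real \<mu> *s u"
    "\<And>z. inner (gram_matrix J A *v z) z \<le> \<mu> * (norm z)\<^sup>2"
proof -
  from assms obtain \<sigma> w where tri: "singular_triple J A \<sigma> u w"
    and top: "\<And>\<sigma>' u' w'. singular_triple J A \<sigma>' u' w' \<Longrightarrow> \<sigma>' \<le> \<sigma>"
    unfolding first_left_singular_vector_def by blast
  obtain m z0 where z0: "norm z0 = 1" "gram_matrix J A *v z0 = complex_of_real m *s z0"
    and le: "\<And>z. inner (gram_matrix J A *v z) z \<le> m * (norm z)\<^sup>2"
    by (rule gram_matrix_top_eigenvector[of J A]) (assumption | rule that)+
  have "m \<le> \<sigma>\<^sup>2"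
  proof (cases "m > 0")
    case True
    define w' where "w' \<beta> = adjoint_apply A z0 \<beta> / sqrt m" for \<beta>
    have sq: "complex_of_real (sqrt m) * complex_of_real (sqrt m) = of_real m"
      using True by (simp flip: of_real_mult)
    have "(\<Sum>\<beta>\<in>J. (cmod (w' \<beta>))\<^sup>2) = (\<Sum>\<beta>\<in>J. inner (adjoint_apply A z0 \<beta>) (adjoint_apply A z0 \<beta>)) / m"
      using True by (simp add: w'_def norm_divide power_divide power2_norm_eq_inner sum_divide_distrib)
    also have "\<dots> = inner (complex_of_real m *s z0) z0 / m"
      by (simp add: inner_gram_matrix[symmetric] z0(2))
    also have "complex_of_real m *s z0 = m *\<^sub>R z0"
      by (simp add: vec_eq_iff scaleR_conv_of_real[where 'a = complex])
    also have "inner (m *\<^sub>R z0) z0 / m = 1"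
      using True z0(1) by (simp add: norm_eq_1)
    finally have 1: "(\<Sum>\<beta>\<in>J. (cmod (w' \<beta>))\<^sup>2) = 1" .
    have 2: "(\<Sum>\<beta>\<in>J. A i \<beta> * w' \<beta>) = complex_of_real (sqrt m) * z0 $ i" for i
    proof -
      have "(\<Sum>\<beta>\<in>J. A i \<beta> * w' \<beta>) = (gram_matrix J A *v z0) $ i / sqrt m"
        by (simp add: gram_matrix_mult w'_def sum_divide_distrib)
      also have "\<dots> = complex_of_real (sqrt m) * z0 $ i"
        using True sq by (simp add: z0(2) field_simps)
      finally show ?thesis .
    qed
    have "singular_triple J A (sqrt m) z0 w'"
      unfolding singular_triple_def using True z0(1) 1 2
      by (simp add: w'_def adjoint_apply_def)
    then have "sqrt m \<le> \<sigma>" by (rule top)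
    then show ?thesis by (rule sqrt_le_D)
  qed (use zero_le_power2[of \<sigma>] in linarith)
  have "(gram_matrix J A *v u) $ i = complex_of_real (\<sigma>\<^sup>2) * u $ i" for i
  proof -
    have "(gram_matrix J A *v u) $ i = (\<Sum>\<beta>\<in>J. \<sigma> * (A i \<beta> * w \<beta>))"
      unfolding gram_matrix_mult adjoint_apply_def
      using tri by (intro sum.cong) (simp_all add: singular_triple_def)
    also have "\<dots> = complex_of_real (\<sigma>\<^sup>2) * u $ i"
      using tri by (simp add: singular_triple_def sum_distrib_left[symmetric] power2_eq_square)
    finally show ?thesis .
  qed
  then have "gram_matrix J A *v u = complex_of_real (\<sigma>\<^sup>2) *s u"
    by (simp add: vec_eq_iff)
  moreover have "inner (gram_matrix J A *v z) z \<le> \<sigma>\<^sup>2 * (norm z)\<^sup>2" for z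
    by (rule order_trans[OF le mult_right_mono[OF \<open>m \<le> \<sigma>\<^sup>2\<close>]]) simp
  ultimately show thesis using tri by (intro that) (auto simp: singular_triple_def)
qed

section \<open>Dominant eigenvectors near a rank one matrix\<close>

text \<open>
  The functional that vanishes on the orthogonal complement of \<open>v\<close> and has the value \<open>1\<close> at \<open>v\<close>,
  for \<open>v \<noteq> 0\<close>.
\<close>

definition dual_covector :: "complex^'n \<Rightarrow> 'n::finite \<Rightarrow> complex" where
  "dual_covector v i = cnj (v $ i) / complex_of_real ((norm v)\<^sup>2)"

lemma cnj_mult_self: "cnj x * x = (complex_of_real (cmod x))\<^sup>2"
  using complex_norm_square[of x] by (simp add: mult.commute)

lemma norm_vec_sq: "complex_of_real ((norm v)\<^sup>2) = (\<Sum>i\<in>UNIV. cnj (v $ i) * v $ i)"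
  for v :: "complex^'n::finite"
proof -
  have "(norm v)\<^sup>2 = (\<Sum>i\<in>UNIV. (cmod (v $ i))\<^sup>2)"
    by (simp add: power2_norm_eq_inner inner_vec_def)
  then show ?thesis
    by (simp add: cnj_mult_self)
qed

lemma covector_dual_self:
  assumes "v \<noteq> 0" shows "covector (dual_covector v) v = 1"
proof -
  have "covector (dual_covector v) v = (\<Sum>i\<in>UNIV. cnj (v $ i) * v $ i) / complex_of_real ((norm v)\<^sup>2)"
    by (simp add: covector_def dual_covector_def sum_divide_distrib)
  with assms show ?thesis by (simp flip: norm_vec_sq)
qed

lemma inner_eq_covector:
  assumes "v \<noteq> 0"
  shows "inner v z = (norm v)\<^sup>2 * Re (covector (dual_covector v) z)"
proof -
  have "inner v z = Re (\<Sum>i\<in>UNIV. cnj (v $ i) * z $ i)"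
    by (simp add: inner_vec_def inner_complex_def)
  also have "(\<Sum>i\<in>UNIV. cnj (v $ i) * z $ i) = complex_of_real ((norm v)\<^sup>2) * covector (dual_covector v) z"
    using assms by (simp add: covector_def dual_covector_def sum_distrib_left)
  finally show ?thesis by (simp del: of_real_power)
qed

lemma inner_rank_one:
  assumes "v \<noteq> 0" and B0: "\<And>i j. B0 $ i $ j = v $ i * dual_covector v j"
  shows "inner (B0 *v z) z = (norm v)\<^sup>2 * (cmod (covector (dual_covector v) z))\<^sup>2"
proof -
  define l where "l = covector (dual_covector v) z"
  have "B0 *v z = l *s v"
    by (simp add: vec_eq_iff matrix_vector_mult_def B0 l_def covector_def sum_distrib_right
        sum_distrib_left mult_ac)
  then have "inner (B0 *v z) z = inner v (cnj l *s z)"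
    by (simp add: inner_vec_def inner_mult_complex)
  also have "\<dots> = (norm v)\<^sup>2 * Re (cnj l * l)"
    using assms(1) by (simp add: inner_eq_covector covector_scale l_def)
  also have "Re (cnj l * l) = (cmod l)\<^sup>2"
    by (simp only: cmod_power2) (simp add: power2_eq_square)
  finally show ?thesis by (simp add: l_def)
qed

lemma inner_matrix_le:
  fixes D :: "complex^'n^'n::finite"
  shows "\<bar>inner (D *v z) z\<bar> \<le> (\<Sum>i\<in>UNIV. \<Sum>j\<in>UNIV. cmod (D $ i $ j)) * (norm z)\<^sup>2"
proof -
  have "\<bar>inner (D *v z) z\<bar> = \<bar>\<Sum>i\<in>UNIV. \<Sum>j\<in>UNIV. inner (D $ i $ j * z $ j) (z $ i)\<bar>"
    by (simp add: inner_vec_def matrix_vector_mult_def inner_sum_left)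
  also have "\<dots> \<le> (\<Sum>i\<in>UNIV. \<Sum>j\<in>UNIV. cmod (D $ i $ j) * (norm z)\<^sup>2)"
    unfolding real_norm_def[symmetric]
  proof (intro sum_norm_le)
    fix i j
    have "\<bar>inner (D $ i $ j * z $ j) (z $ i)\<bar> \<le> cmod (D $ i $ j) * norm (z $ j) * norm (z $ i)"
      using Cauchy_Schwarz_ineq2[of "D $ i $ j * z $ j" "z $ i"] by (simp add: norm_mult)
    also have "\<dots> \<le> cmod (D $ i $ j) * norm z * norm z"
      by (intro mult_mono Finite_Cartesian_Product.norm_nth_le) auto
    finally show "norm (inner (D $ i $ j * z $ j) (z $ i)) \<le> cmod (D $ i $ j) * (norm z)\<^sup>2"
      by (simp add: power2_eq_square mult.assoc)
  qed
  finally show ?thesis by (simp add: sum_distrib_right)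
qed

text \<open>
  Both \<open>u\<close> and \<open>v / |v|\<close> can be tested in the quadratic form of \<open>B\<close>. It is at least \<open>1 - e\<close> at the
  latter, hence also at \<open>u\<close>, whereas at \<open>u\<close> it is at most \<open>|v|\<^sup>2 |\<ell>(u)|\<^sup>2 + e\<close>. So \<open>|v| |\<ell>(u)|\<close> is nearly
  \<open>1\<close>, that is, \<open>u\<close> is nearly parallel to \<open>v\<close>.
\<close>

lemma dominant_eigenvector_near_rank_one:
  fixes B B0 :: "complex^'n^'n::finite"
  assumes v: "v \<noteq> 0" and B0: "\<And>i j. B0 $ i $ j = v $ i * dual_covector v j"
    and u: "norm u = 1" "B *v u = complex_of_real \<mu> *s u"
    and dom: "\<And>z. inner (B *v z) z \<le> \<mu> * (norm z)\<^sup>2"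
    and e: "e = (\<Sum>i\<in>UNIV. \<Sum>j\<in>UNIV. cmod (B $ i $ j - B0 $ i $ j))" "e < 1 / 2"
  shows "covector (dual_covector v) u \<noteq> 0"
    and "(norm ((1 / covector (dual_covector v) u) *s u - v))\<^sup>2 \<le> (norm v)\<^sup>2 * (2 * e / (1 - 2 * e))"
proof -
  define l where "l = covector (dual_covector v) u"
  have close: "\<bar>inner (B *v z) z - (norm v)\<^sup>2 * (cmod (covector (dual_covector v) z))\<^sup>2\<bar> \<le> e * (norm z)\<^sup>2" for z
    using inner_matrix_le[of "B - B0" z]
    by (simp add: matrix_vector_mult_diff_rdistrib inner_diff_left inner_rank_one[OF v B0] e)
  have nv: "(norm v)\<^sup>2 > 0" using v by simp
  have "complex_of_real \<mu> *s u = \<mu> *\<^sub>R u"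
    by (simp add: vec_eq_iff scaleR_conv_of_real[where 'a = complex])
  then have "inner (B *v u) u = \<mu>" using u by (simp add: norm_eq_1)
  then have 1: "\<mu> \<le> (norm v)\<^sup>2 * (cmod l)\<^sup>2 + e"
    using close[of u] u(1) by (simp add: l_def)
  have "(norm v)\<^sup>2 - e * (norm v)\<^sup>2 \<le> \<mu> * (norm v)\<^sup>2"
    using close[of v] dom[of v] by (simp add: covector_dual_self[OF v])
  then have "(1 - e) * (norm v)\<^sup>2 \<le> \<mu> * (norm v)\<^sup>2" by (simp add: algebra_simps)
  then have "1 - e \<le> \<mu>" using nv by (simp only: mult_le_cancel_right_pos)
  with 1 have 2: "1 - 2 * e \<le> (norm v)\<^sup>2 * (cmod l)\<^sup>2" by simp
  with e(2) have l0: "l \<noteq> 0" by auto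
  then show "covector (dual_covector v) u \<noteq> 0" by (simp add: l_def)
  define y where "y = (1 / l) *s u"
  have "inner v y = (norm v)\<^sup>2"
    using l0 by (simp add: inner_eq_covector[OF v] y_def covector_scale l_def)
  moreover have "(norm y)\<^sup>2 = 1 / (cmod l)\<^sup>2"
  proof -
    have "complex_of_real ((norm y)\<^sup>2) = cnj (1 / l) * (1 / l) * complex_of_real ((norm u)\<^sup>2)"
      unfolding norm_vec_sq by (simp add: y_def sum_distrib_left mult_ac sum_divide_distrib)
    also have "\<dots> = complex_of_real (1 / (cmod l)\<^sup>2)"
      using cnj_mult_self[of l] by (simp add: u(1))
    finally show ?thesis by (simp only: of_real_eq_iff)
  qed
  ultimately have "(norm (y - v))\<^sup>2 = 1 / (cmod l)\<^sup>2 - (norm v)\<^sup>2"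
    by (simp add: power2_norm_eq_inner inner_diff_left inner_diff_right inner_commute)
  moreover have "1 / (cmod l)\<^sup>2 \<le> (norm v)\<^sup>2 / (1 - 2 * e)"
    using 2 e(2) l0 by (simp add: field_simps)
  moreover have "(norm v)\<^sup>2 / (1 - 2 * e) - (norm v)\<^sup>2 = (norm v)\<^sup>2 * (2 * e / (1 - 2 * e))"
    using e(2) by (simp add: field_simps)
  ultimately show "(norm ((1 / covector (dual_covector v) u) *s u - v))\<^sup>2 \<le> (norm v)\<^sup>2 * (2 * e / (1 - 2 * e))"
    by (simp add: y_def l_def)
qed

section \<open>The normed space of polynomials\<close>

lemma lookup_scaleR: "poly_mapping.lookup (r *\<^sub>R p) \<alpha> = r *\<^sub>R poly_mapping.lookup p \<alpha>"
  for p :: "'a \<Rightarrow>\<^sub>0 'b::real_vector"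
proof -
  have "finite {i. r *\<^sub>R poly_mapping.lookup p i \<noteq> 0}"
    by (rule finite_subset[OF _ finite_lookup[of p]]) auto
  then show ?thesis by (simp add: scaleR_poly_mapping_def)
qed

lemma norm_eq_sum_keys: "norm p = (\<Sum>\<alpha>\<in>Poly_Mapping.keys p. norm (poly_mapping.lookup p \<alpha>))"
  for p :: "'a \<Rightarrow>\<^sub>0 'b::real_normed_vector"
  by (simp add: norm_poly_mapping_def dist_poly_mapping_def)

lemma bounded_linear_lookup: "bounded_linear (\<lambda>p :: 'a \<Rightarrow>\<^sub>0 'b::real_normed_vector. poly_mapping.lookup p \<alpha>)"
proof (rule bounded_linear_intro[where K = 1])
  fix p :: "'a \<Rightarrow>\<^sub>0 'b"
  show "norm (poly_mapping.lookup p \<alpha>) \<le> norm p * 1"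
  proof (cases "\<alpha> \<in> Poly_Mapping.keys p")
    case True
    then show ?thesis
      unfolding norm_eq_sum_keys mult_1_right
      by (intro member_le_sum[where f = "\<lambda>\<alpha>. norm (poly_mapping.lookup p \<alpha>)"]) auto
  qed (simp add: in_keys_iff)
qed (simp_all add: lookup_add lookup_scaleR)

lemma bounded_linear_single: "bounded_linear (Poly_Mapping.single \<alpha> :: 'b::real_normed_vector \<Rightarrow> _)"
proof (rule bounded_linear_intro[where K = 1])
  fix c :: 'b
  show "norm (Poly_Mapping.single \<alpha> c) \<le> norm c * 1"
    by (cases "c = 0") (simp_all add: norm_eq_sum_keys)
next
  fix r and c :: 'b
  show "Poly_Mapping.single \<alpha> (r *\<^sub>R c) = r *\<^sub>R Poly_Mapping.single \<alpha> c"
    by (rule poly_mapping_eqI) (simp add: lookup_scaleR lookup_single when_def)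
qed (simp add: single_add)

lemma lookup_const_mult: "poly_mapping.lookup (Poly_Mapping.single 0 c * p) \<alpha> = c * poly_mapping.lookup p \<alpha>"
  for p :: "'a::monoid_add \<Rightarrow>\<^sub>0 'b::semiring_0"
  unfolding mult_map_scale_conv_mult[symmetric] by (simp add: Poly_Mapping.map.rep_eq when_def)

lemma const_power: "Poly_Mapping.single 0 c ^ k = Poly_Mapping.single 0 (c ^ k)"
  for c :: complex
  by (induction k) (simp_all add: mult_single flip: single_one)

text \<open>
  Multiplication by constant polynomials is the bridge between the ring structure, in which the
  Veronese map is a power, and the real vector space structure, in which derivatives live.
\<close>

lemma const_mult_eq_scaleR: "Poly_Mapping.single 0 (complex_of_real r) * p = r *\<^sub>R p"
  for p :: "('n::finite) cpoly"
  by (rule poly_mapping_eqI) (simp add: lookup_const_mult lookup_scaleR scaleR_conv_of_real)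

section \<open>Powers of linear forms and the apolar product\<close>

definition vpow :: "complex^'n \<Rightarrow> ('n::finite \<Rightarrow>\<^sub>0 nat) \<Rightarrow> complex" where
  "vpow v \<alpha> = (\<Prod>i\<in>UNIV. v $ i ^ poly_mapping.lookup \<alpha> i)"

lemma mdeg_add: "mdeg (\<alpha> + \<beta>) = mdeg \<alpha> + mdeg \<beta>"
  by (simp add: mdeg_def lookup_add sum.distrib)

lemma mdeg_single: "mdeg (Poly_Mapping.single i k) = k"
  by (simp add: mdeg_def lookup_single when_def)

lemma vpow_add: "vpow v (\<alpha> + \<beta>) = vpow v \<alpha> * vpow v \<beta>"
  by (simp add: vpow_def lookup_add power_add prod.distrib)

lemma vpow_single: "vpow v (Poly_Mapping.single i k) = v $ i ^ k"
proof -
  have "vpow v (Poly_Mapping.single i k) = (\<Prod>j\<in>UNIV. if i = j then v $ j ^ k else 1)"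
    unfolding vpow_def by (rule prod.cong) (auto simp: lookup_single when_def)
  then show ?thesis by simp
qed

lemma multinomial_add_single:
  "of_nat (Suc d) * multinomial d \<alpha> =
   of_nat (Suc (poly_mapping.lookup \<alpha> i)) * multinomial (Suc d) (Poly_Mapping.single i 1 + \<alpha>)"
proof -
  have "(\<Prod>j\<in>UNIV. fact (poly_mapping.lookup (Poly_Mapping.single i 1 + \<alpha>) j) :: complex) =
      (\<Prod>j\<in>UNIV. (if i = j then of_nat (Suc (poly_mapping.lookup \<alpha> j)) else 1) * fact (poly_mapping.lookup \<alpha> j))"
    by (rule prod.cong) (auto simp: lookup_add lookup_single when_def)
  also have "\<dots> = of_nat (Suc (poly_mapping.lookup \<alpha> i)) * (\<Prod>j\<in>UNIV. fact (poly_mapping.lookup \<alpha> j))"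
    by (simp add: prod.distrib)
  finally have *: "(\<Prod>j\<in>UNIV. fact (poly_mapping.lookup (Poly_Mapping.single i 1 + \<alpha>) j) :: complex) =
      of_nat (Suc (poly_mapping.lookup \<alpha> i)) * (\<Prod>j\<in>UNIV. fact (poly_mapping.lookup \<alpha> j))" .
  show ?thesis
    unfolding multinomial_def * by (simp add: fact_Suc del: of_nat_Suc)
qed

text \<open>
  The multinomial theorem, by induction on \<open>d\<close>. Multiplying by one more linear form, the coefficient
  of \<open>x\<^sup>\<gamma>\<close> collects one contribution for each \<open>i\<close> with \<open>\<gamma>\<^sub>i > 0\<close>, and that contribution is the fraction
  \<open>\<gamma>\<^sub>i / (d + 1)\<close> of the asserted coefficient.
\<close>

lemma linear_form_power:
  "linear_form v ^ d = (\<Sum>\<alpha> | mdeg \<alpha> = d. Poly_Mapping.single \<alpha> (multinomial d \<alpha> * vpow v \<alpha>))"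
proof (induction d)
  case 0
  have "{\<alpha> :: 'a \<Rightarrow>\<^sub>0 nat. mdeg \<alpha> = 0} = {0}"
    by (auto simp: mdeg_def intro!: poly_mapping_eqI)
  then show ?case by (simp add: multinomial_def vpow_def)
next
  case (Suc d)
  let ?e = "\<lambda>i. Poly_Mapping.single i (1::nat)"
  show ?case
  proof (rule poly_mapping_eqI)
    fix \<gamma> :: "'a \<Rightarrow>\<^sub>0 nat"
    have summand: "(\<Sum>\<alpha> | mdeg \<alpha> = d. v $ i * (multinomial d \<alpha> * vpow v \<alpha>) when ?e i + \<alpha> = \<gamma>) =
        (if mdeg \<gamma> = Suc d
         then of_nat (poly_mapping.lookup \<gamma> i) / of_nat (Suc d) * (multinomial (Suc d) \<gamma> * vpow v \<gamma>) else 0)" for i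
    proof (cases "poly_mapping.lookup \<gamma> i = 0")
      case True
      have "?e i + \<alpha> \<noteq> \<gamma>" for \<alpha>
      proof
        assume "?e i + \<alpha> = \<gamma>"
        then have "poly_mapping.lookup (?e i + \<alpha>) i = 0" using True by simp
        then show False by (simp add: lookup_add)
      qed
      then show ?thesis using True by (simp add: when_def)
    next
      case False
      define \<alpha>0 where "\<alpha>0 = Poly_Mapping.update i (poly_mapping.lookup \<gamma> i - 1) \<gamma>"
      have \<gamma>: "\<gamma> = ?e i + \<alpha>0"
        using False by (intro poly_mapping_eqI)
          (auto simp: \<alpha>0_def lookup_add lookup_update lookup_single when_def)
      have "(\<Sum>\<alpha> | mdeg \<alpha> = d. v $ i * (multinomial d \<alpha> * vpow v \<alpha>) when ?e i + \<alpha> = \<gamma>) =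
          (\<Sum>\<alpha> | mdeg \<alpha> = d. if \<alpha>0 = \<alpha> then v $ i * (multinomial d \<alpha> * vpow v \<alpha>) else 0)"
        by (rule sum.cong) (auto simp: \<gamma> when_def)
      also have "\<dots> = (if mdeg \<alpha>0 = d then v $ i * (multinomial d \<alpha>0 * vpow v \<alpha>0) else 0)"
        by (simp add: finite_mdeg_eq)
      also have "\<dots> = (if mdeg \<gamma> = Suc d
          then of_nat (poly_mapping.lookup \<gamma> i) / of_nat (Suc d) * (multinomial (Suc d) \<gamma> * vpow v \<gamma>) else 0)"
      proof -
        have "poly_mapping.lookup \<gamma> i = Suc (poly_mapping.lookup \<alpha>0 i)"
          by (simp add: \<gamma> lookup_add)
        then have "of_nat (poly_mapping.lookup \<gamma> i) / of_nat (Suc d) * multinomial (Suc d) \<gamma> = multinomial d \<alpha>0"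
          using multinomial_add_single[of d \<alpha>0 i] unfolding \<gamma>[symmetric]
          by (simp add: field_simps del: of_nat_Suc)
        moreover have "vpow v \<gamma> = v $ i * vpow v \<alpha>0"
          by (subst \<gamma>) (simp add: vpow_add vpow_single)
        ultimately have "of_nat (poly_mapping.lookup \<gamma> i) / of_nat (Suc d) * (multinomial (Suc d) \<gamma> * vpow v \<gamma>)
            = v $ i * (multinomial d \<alpha>0 * vpow v \<alpha>0)"
          by (simp only: mult.assoc[symmetric]) (simp only: mult_ac)
        moreover have "mdeg \<gamma> = Suc d \<longleftrightarrow> mdeg \<alpha>0 = d"
          by (subst \<gamma>) (simp add: mdeg_add mdeg_single)
        ultimately show ?thesis by simp
      qed
      finally show ?thesis .
    qed
    have "linear_form v ^ Suc d = (\<Sum>i\<in>UNIV. \<Sum>\<alpha> | mdeg \<alpha> = d.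
        Poly_Mapping.single (?e i + \<alpha>) (v $ i * (multinomial d \<alpha> * vpow v \<alpha>)))"
      by (simp add: Suc.IH sum_product mult_single) (simp add: linear_form_def sum_product mult_single)
    then have "poly_mapping.lookup (linear_form v ^ Suc d) \<gamma> =
        (\<Sum>i\<in>UNIV. if mdeg \<gamma> = Suc d
         then of_nat (poly_mapping.lookup \<gamma> i) / of_nat (Suc d) * (multinomial (Suc d) \<gamma> * vpow v \<gamma>) else 0)"
      by (simp only: lookup_sum lookup_single summand)
    also have "\<dots> = (if mdeg \<gamma> = Suc d then multinomial (Suc d) \<gamma> * vpow v \<gamma> else 0)"
    proof -
      have "(\<Sum>i\<in>UNIV. of_nat (poly_mapping.lookup \<gamma> i) / of_nat (Suc d) * c) = of_nat (mdeg \<gamma>) / of_nat (Suc d) * c"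
        for c :: complex
        by (simp add: mdeg_def sum_distrib_right sum_divide_distrib)
      then show ?thesis by (simp del: of_nat_Suc)
    qed
    also have "\<dots> = poly_mapping.lookup (\<Sum>\<alpha> | mdeg \<alpha> = Suc d.
        Poly_Mapping.single \<alpha> (multinomial (Suc d) \<alpha> * vpow v \<alpha>)) \<gamma>"
      by (simp add: lookup_sum lookup_single when_def finite_mdeg_eq)
    finally show "poly_mapping.lookup (linear_form v ^ Suc d) \<gamma> = poly_mapping.lookup (\<Sum>\<alpha> | mdeg \<alpha> = Suc d.
        Poly_Mapping.single \<alpha> (multinomial (Suc d) \<alpha> * vpow v \<alpha>)) \<gamma>" .
  qed
qed

lemma veronese_map_eq_sum:
  "veronese_map d v = (\<Sum>\<alpha> | mdeg \<alpha> = d. Poly_Mapping.single \<alpha> (multinomial d \<alpha> * vpow v \<alpha>))"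
  by (simp add: veronese_map_def linear_form_power)

lemma multinomial_nonzero: "multinomial d \<alpha> \<noteq> 0"
  by (simp add: multinomial_def)

lemma ncoeff_veronese_map: "mdeg \<alpha> = d \<Longrightarrow> ncoeff d (veronese_map d v) \<alpha> = vpow v \<alpha>"
  by (simp add: ncoeff_def veronese_map_eq_sum lookup_sum lookup_single when_def finite_mdeg_eq
      multinomial_nonzero)

lemma apolar_veronese_map:
  "apolar d (veronese_map d v) q =
     (\<Sum>\<alpha> | mdeg \<alpha> = d. multinomial d \<alpha> * cnj (vpow v \<alpha>) * ncoeff d q \<alpha>)"
  unfolding apolar_def by (rule sum.cong) (simp_all add: ncoeff_veronese_map)

text \<open>
  The multinomial coefficients are positive, so \<open>\<langle>q, q\<rangle>\<close> is a positive definite sum of squares; the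
  norm, defined through a real part and a square root, loses no information.
\<close>

lemma apolar_self_eq_apolar_norm:
  "apolar d q q = complex_of_real ((apolar_norm d q)\<^sup>2)"
  "q \<in> forms d \<Longrightarrow> q \<noteq> 0 \<Longrightarrow> apolar d q q \<noteq> 0"
proof -
  define m where "m \<alpha> = (fact d / (\<Prod>i\<in>UNIV. fact (poly_mapping.lookup \<alpha> i)) :: real)" for \<alpha> :: "'a \<Rightarrow>\<^sub>0 nat"
  have m: "m \<alpha> > 0" "multinomial d \<alpha> = complex_of_real (m \<alpha>)" for \<alpha>
    by (auto simp: m_def multinomial_def intro!: divide_pos_pos prod_pos)
  have "apolar d q q = complex_of_real (\<Sum>\<alpha> | mdeg \<alpha> = d. m \<alpha> * (cmod (ncoeff d q \<alpha>))\<^sup>2)"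
    unfolding apolar_def m(2) mult.assoc cnj_mult_self by simp
  moreover define r where "r = (\<Sum>\<alpha> | mdeg \<alpha> = d. m \<alpha> * (cmod (ncoeff d q \<alpha>))\<^sup>2)"
  ultimately have r: "apolar d q q = complex_of_real r" by simp
  have nonneg: "0 \<le> m \<alpha> * (cmod (ncoeff d q \<alpha>))\<^sup>2" for \<alpha>
    using m(1)[of \<alpha>] by simp
  then have "0 \<le> r" unfolding r_def by (intro sum_nonneg)
  with r show "apolar d q q = complex_of_real ((apolar_norm d q)\<^sup>2)"
    by (simp add: apolar_norm_def)
  assume "q \<in> forms d" "q \<noteq> 0"
  then obtain \<alpha> where \<alpha>: "poly_mapping.lookup q \<alpha> \<noteq> 0" "mdeg \<alpha> = d"
    unfolding forms_def by (metis (mono_tags, lifting) in_keys_iff lookup_zero mem_Collect_eq poly_mapping_eqI)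
  then have "0 < m \<alpha> * (cmod (ncoeff d q \<alpha>))\<^sup>2"
    using m(1)[of \<alpha>] by (simp add: ncoeff_def multinomial_nonzero)
  also have "\<dots> \<le> r"
    unfolding r_def using \<alpha>(2) nonneg by (intro member_le_sum) (auto simp: finite_mdeg_eq)
  finally show "apolar d q q \<noteq> 0" by (simp add: r)
qed

lemma forms_add: "p \<in> forms d \<Longrightarrow> q \<in> forms d \<Longrightarrow> p + q \<in> forms d"
  using Poly_Mapping.keys_add[of p q] unfolding forms_def by blast

lemma forms_uminus: "p \<in> forms d \<Longrightarrow> - p \<in> forms d"
  by (simp add: forms_def)

lemma forms_mult: "p \<in> forms a \<Longrightarrow> q \<in> forms b \<Longrightarrow> p * q \<in> forms (a + b)"
  using keys_mult[of p q] unfolding forms_def by (fastforce simp: mdeg_add)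

lemma linear_form_forms: "linear_form v \<in> forms 1"
proof -
  have "poly_mapping.lookup (linear_form v) \<alpha> = 0" if "mdeg \<alpha> \<noteq> 1" for \<alpha>
    using that mdeg_single by (fastforce simp: linear_form_def lookup_sum lookup_single when_def intro!: sum.neutral)
  then show ?thesis unfolding forms_def by (auto simp: in_keys_iff)
qed

lemma linear_form_power_forms: "linear_form v ^ d \<in> forms d"
proof (induction d)
  case 0
  show ?case by (simp add: forms_def mdeg_def)
next
  case (Suc d)
  show ?case using forms_mult[OF linear_form_forms Suc] by simp
qed

lemma veronese_map_forms: "veronese_map d v \<in> forms d"
  unfolding veronese_map_def by (rule linear_form_power_forms)

lemma veronese_tangent_subset_forms:
  assumes "d > 0" shows "veronese_tangent d p \<subseteq> forms d"
  using forms_mult[OF linear_form_forms linear_form_power_forms[of _ "d - 1"]] assms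
  unfolding veronese_tangent_def by auto

lemma veronese_map_nonzero:
  assumes "v \<noteq> 0" shows "veronese_map d v \<noteq> 0"
proof
  assume "veronese_map d v = 0"
  moreover from assms obtain i where "v $ i \<noteq> 0" by (auto simp: vec_eq_iff)
  moreover have "ncoeff d (veronese_map d v) (Poly_Mapping.single i d) = v $ i ^ d"
    by (simp add: ncoeff_veronese_map mdeg_single vpow_single)
  ultimately show False by (simp add: ncoeff_def)
qed

lemma apolar_veronese_map_self_nonzero:
  "v \<noteq> 0 \<Longrightarrow> apolar d (veronese_map d v) (veronese_map d v) \<noteq> 0"
  by (simp add: apolar_self_eq_apolar_norm(2) veronese_map_forms veronese_map_nonzero)

section \<open>Projections onto lines of the Veronese cone\<close>

lemma veronese_proj_eq:
  "veronese_proj d v q = Poly_Mapping.single 0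
     (apolar d (veronese_map d v) q / apolar d (veronese_map d v) (veronese_map d v)) * veronese_map d v"
  unfolding veronese_proj_def apolar_self_eq_apolar_norm(1)[of d "veronese_map d v"] ..

lemma veronese_proj_self: "v \<noteq> 0 \<Longrightarrow> veronese_proj d v (veronese_map d v) = veronese_map d v"
  by (simp add: veronese_proj_eq apolar_veronese_map_self_nonzero)

lemma linear_form_add: "linear_form (u + v) = linear_form u + linear_form v"
  by (simp add: linear_form_def single_add sum.distrib)

lemma linear_form_scale: "linear_form (c *s v) = Poly_Mapping.single 0 c * linear_form v"
  by (simp add: linear_form_def sum_distrib_left mult_single)

lemma veronese_map_scale:
  "veronese_map d (c *s v) = Poly_Mapping.single 0 (c ^ d) * veronese_map d v"
  by (simp add: veronese_map_def linear_form_scale power_mult_distrib const_power)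

lemma apolar_const_mult:
  "apolar d (Poly_Mapping.single 0 c * p) q = cnj c * apolar d p q"
  "apolar d p (Poly_Mapping.single 0 c * q) = c * apolar d p q"
proof -
  have "ncoeff d (Poly_Mapping.single 0 c * p) \<alpha> = c * ncoeff d p \<alpha>" for p :: "'a cpoly" and \<alpha>
    by (simp add: ncoeff_def lookup_const_mult)
  then show "apolar d (Poly_Mapping.single 0 c * p) q = cnj c * apolar d p q"
    "apolar d p (Poly_Mapping.single 0 c * q) = c * apolar d p q"
    by (simp_all add: apolar_def sum_distrib_left mult_ac)
qed

text \<open>
  The factor \<open>c\<^sup>d\<close> of \<open>\<psi>(c v)\<close> occurs in the projection together with its conjugate, once in the
  numerator and once in the denominator. So the choice of a singular vector on its line is
  irrelevant.
\<close>

lemma veronese_proj_scale: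
  assumes "c \<noteq> 0" shows "veronese_proj d (c *s v) q = veronese_proj d v q"
  unfolding veronese_proj_eq veronese_map_scale apolar_const_mult mult.assoc[symmetric] mult_single
  using assms by simp

text \<open>
  A non-zero complex scalar is a \<open>d\<close>-th power and can be moved into the linear form.
\<close>

lemma veronese_proj_in_veronese:
  assumes "d > 0" "v \<noteq> 0" "apolar d (veronese_map d v) q \<noteq> 0"
  shows "veronese_proj d v q \<in> veronese d"
proof -
  let ?c = "apolar d (veronese_map d v) q / apolar d (veronese_map d v) (veronese_map d v)"
  have "?c \<noteq> 0" using assms by (simp add: apolar_veronese_map_self_nonzero)
  then obtain r where r: "r ^ d = ?c" "r \<noteq> 0"
    using assms(1) by (metis exists_complex_root_nonzero not_gr_zero)
  then have "veronese_proj d v q = veronese_map d (r *s v)"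
    by (simp add: veronese_proj_eq veronese_map_scale)
  moreover have "r *s v \<noteq> 0" using r(2) assms(2) by simp
  ultimately show ?thesis unfolding veronese_def by blast
qed

section \<open>Hankel matrices of powers of linear forms\<close>

lemma hankel_veronese_map:
  assumes "d > 0" "mdeg \<beta> = d - 1"
  shows "hankel d (veronese_map d v) i \<beta> = v $ i * vpow v \<beta>"
proof -
  have "mdeg (Poly_Mapping.single i 1 + \<beta>) = d"
    using assms by (simp add: mdeg_add mdeg_single)
  then show ?thesis
    using hankel_eq_ncoeff[OF assms, of "veronese_map d v" i]
    by (simp add: ncoeff_veronese_map vpow_add vpow_single)
qed

text \<open>
  The non-zero eigenvalue of \<open>H H\<^sup>*\<close> at \<open>(v\<^sup>t x)\<^sup>d\<close>.
\<close>

definition veronese_gram_scale :: "nat \<Rightarrow> complex^'n::finite \<Rightarrow> real" where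
  "veronese_gram_scale d v = (norm v)\<^sup>2 * (\<Sum>\<beta> | mdeg \<beta> = d - 1. (cmod (vpow v \<beta>))\<^sup>2)"

lemma veronese_gram_scale_pos:
  assumes "v \<noteq> 0" shows "veronese_gram_scale d v > 0"
proof -
  from assms obtain i where i: "v $ i \<noteq> 0" by (auto simp: vec_eq_iff)
  let ?\<beta> = "Poly_Mapping.single i (d - 1)"
  have "0 < (cmod (vpow v ?\<beta>))\<^sup>2" using i by (simp add: vpow_single)
  also have "\<dots> \<le> (\<Sum>\<beta> | mdeg \<beta> = d - 1. (cmod (vpow v \<beta>))\<^sup>2)"
    by (rule member_le_sum) (auto simp: mdeg_single finite_mdeg_eq)
  finally show ?thesis using assms by (simp add: veronese_gram_scale_def)
qed

lemma gram_matrix_veronese_map: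
  assumes "d > 0" "v \<noteq> 0"
  shows "gram_matrix {\<beta>. mdeg \<beta> = d - 1} (hankel d (veronese_map d v)) $ i $ j =
    complex_of_real (veronese_gram_scale d v) * (v $ i * dual_covector v j)"
proof -
  have "gram_matrix {\<beta>. mdeg \<beta> = d - 1} (hankel d (veronese_map d v)) $ i $ j =
      (\<Sum>\<beta> | mdeg \<beta> = d - 1. v $ i * cnj (v $ j) * (cnj (vpow v \<beta>) * vpow v \<beta>))"
    unfolding gram_matrix_def vec_lambda_beta
    by (rule sum.cong) (simp_all add: hankel_veronese_map assms mult_ac)
  also have "\<dots> = v $ i * cnj (v $ j) * complex_of_real (\<Sum>\<beta> | mdeg \<beta> = d - 1. (cmod (vpow v \<beta>))\<^sup>2)"
    unfolding cnj_mult_self by (simp add: sum_distrib_left)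
  finally show ?thesis
    using assms(2) by (simp add: veronese_gram_scale_def dual_covector_def)
qed

text \<open>
  \<open>H H\<^sup>*\<close> maps everything to the line of \<open>v\<close>. Domination, tested at \<open>v\<close>, shows that the
  eigenvalue of \<open>u\<close> is positive, so \<open>u\<close> lies in that image.
\<close>

lemma first_left_singular_vector_veronese_map:
  assumes "d > 0" "v \<noteq> 0"
    "first_left_singular_vector {\<beta>. mdeg \<beta> = d - 1} (hankel d (veronese_map d v)) u"
  obtains c where "c \<noteq> 0" "u = c *s v"
proof -
  let ?M = "gram_matrix {\<beta>. mdeg \<beta> = d - 1} (hankel d (veronese_map d v))"
  let ?s = "veronese_gram_scale d v"
  obtain \<mu> where u: "norm u = 1" "?M *v u = complex_of_real \<mu> *s u"
    and dom: "\<And>z. inner (?M *v z) z \<le> \<mu> * (norm z)\<^sup>2"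
    using first_left_singular_vector_dominates[OF assms(3)] by metis
  have g: "?M $ i $ j = complex_of_real ?s * (v $ i * dual_covector v j)" for i j
    by (rule gram_matrix_veronese_map[OF assms(1,2)])
  have M: "?M *v z = (complex_of_real ?s * covector (dual_covector v) z) *s v" for z
    unfolding vec_eq_iff matrix_vector_mult_def vec_lambda_beta g
    by (simp add: covector_def sum_distrib_left sum_distrib_right mult_ac)
  have "?M *v v = ?s *\<^sub>R v"
    unfolding M covector_dual_self[OF assms(2)]
    by (simp add: vec_eq_iff scaleR_conv_of_real[where 'a = complex])
  then have "?s * (norm v)\<^sup>2 \<le> \<mu> * (norm v)\<^sup>2"
    using dom[of v] by (simp add: power2_norm_eq_inner)
  then have "\<mu> > 0"
    using veronese_gram_scale_pos[OF assms(2), of d] assms(2) by (simp add: mult_le_cancel_right)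
  then have "u = (complex_of_real ?s * covector (dual_covector v) u / complex_of_real \<mu>) *s v"
    using M[of u] u(2) by (simp add: vec_eq_iff field_simps)
  moreover from this have "complex_of_real ?s * covector (dual_covector v) u / complex_of_real \<mu> \<noteq> 0"
    using u(1) by (metis norm_zero vector_smult_lzero zero_neq_one)
  ultimately show thesis using that by blast
qed

section \<open>Smooth dependence of the top singular vector on the form\<close>

lemma bounded_linear_ncoeff: "bounded_linear (\<lambda>h. ncoeff d h \<alpha>)"
  unfolding ncoeff_def divide_inverse
  by (rule bounded_linear_mult_const[OF bounded_linear_lookup])

lemma ncoeff_add: "ncoeff d (p + q) \<alpha> = ncoeff d p \<alpha> + ncoeff d q \<alpha>"
  by (simp add: ncoeff_def lookup_add add_divide_distrib)

text \<open>
  Being bounded linear in \<open>q\<close> up to a constant, these functions generate an algebra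
  closed under derivatives on the whole space of polynomials.
\<close>

definition shifted_coeffs :: "nat \<Rightarrow> ('n::finite) cpoly \<Rightarrow> ('n cpoly \<Rightarrow> complex) set" where
  "shifted_coeffs d p = range (\<lambda>\<alpha> q. ncoeff d (p + q) \<alpha>)"

lemma shifted_coeffs_differentiate:
  assumes "g \<in> shifted_coeffs d p" "shifted_coeffs d p \<subseteq> G"
  shows "g \<in> func_algebra U G \<and> differentiates_into T U (func_algebra U G) g"
proof -
  from assms(1) obtain \<alpha> where g: "g = (\<lambda>q. ncoeff d (p + q) \<alpha>)"
    by (auto simp: shifted_coeffs_def)
  have "(g has_derivative (\<lambda>h. ncoeff d h \<alpha>)) (at x within U)" for x
    unfolding g ncoeff_add
    by (rule has_derivative_eq_rhs, rule has_derivative_add[OF has_derivative_const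
          bounded_linear_imp_has_derivative[OF bounded_linear_ncoeff]]) simp
  then have "differentiates_into T U (func_algebra U G) g"
    unfolding differentiates_into_def
    by (intro exI[of _ "\<lambda>x h. ncoeff d h \<alpha>"]) (auto intro: func_algebra.const)
  with assms show ?thesis by (auto intro: func_algebra.gen)
qed

lemma gram_matrix_in_func_algebra:
  assumes "d > 0" "shifted_coeffs d p \<subseteq> G"
  shows "(\<lambda>q. gram_matrix {\<beta>. mdeg \<beta> = d - 1} (hankel d (p + q)) $ i $ j) \<in> func_algebra U G"
proof -
  have "(\<lambda>q. ncoeff d (p + q) \<alpha>) \<in> func_algebra U G" for \<alpha>
    using assms(2) by (intro func_algebra.gen) (auto simp: shifted_coeffs_def)
  then have "(\<lambda>q. \<Sum>\<beta> | mdeg \<beta> = d - 1. ncoeff d (p + q) (Poly_Mapping.single i 1 + \<beta>) *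
      cnj (ncoeff d (p + q) (Poly_Mapping.single j 1 + \<beta>))) \<in> func_algebra U G"
    by (intro func_algebra_sum func_algebra.mult func_algebra.cnj)
  also have "(\<lambda>q. \<Sum>\<beta> | mdeg \<beta> = d - 1. ncoeff d (p + q) (Poly_Mapping.single i 1 + \<beta>) *
      cnj (ncoeff d (p + q) (Poly_Mapping.single j 1 + \<beta>))) =
      (\<lambda>q. gram_matrix {\<beta>. mdeg \<beta> = d - 1} (hankel d (p + q)) $ i $ j)"
    unfolding gram_matrix_def vec_lambda_beta
    by (intro ext sum.cong refl) (simp add: hankel_eq_ncoeff[OF assms(1)])
  finally show ?thesis .
qed

lemma func_algebra_shifted_coeffs_tendsto:
  assumes "f \<in> func_algebra UNIV (shifted_coeffs d p)"
  shows "(f \<longlongrightarrow> f x) (nhds x)"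
proof -
  have "differentiates_into UNIV UNIV (func_algebra UNIV (shifted_coeffs d p)) f"
    using func_algebra_differentiates[OF _ assms, of "shifted_coeffs d p"]
      shifted_coeffs_differentiate by blast
  then obtain f' where "(f has_derivative f' x) (at x)"
    unfolding differentiates_into_def by auto
  then have "isCont f x" by (rule has_derivative_continuous)
  then show ?thesis by (simp add: continuous_at tendsto_at_iff_tendsto_nhds)
qed

text \<open>
  The vectors \<open>\<theta>(p + q)\<close> have arbitrary phases; dividing by \<open>\<ell>(\<theta>(p + q))\<close> removes the phase and gives
  the representative \<open>y\<close>, which varies smoothly. The neighbourhood is taken in all of \<open>forms d\<close> and not
  in the tangent space only, because the derivative is later computed along curves in the Veronese
  manifold, which leave the tangent space.
\<close>

lemma smooth_top_eigenvector:
  fixes v :: "complex^'n::finite" and \<theta> :: "'n cpoly \<Rightarrow> complex^'n"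
  assumes d: "d > 0" and v: "v \<noteq> 0" and p: "p = veronese_map d v"
    and \<theta>: "\<And>f. f \<in> forms d \<Longrightarrow>
      first_left_singular_vector {\<beta>. mdeg \<beta> = d - 1} (hankel d f) (\<theta> f)"
  obtains S y where "open S" "0 \<in> S"
    "\<And>q. q \<in> S \<inter> forms d \<Longrightarrow> \<exists>c. c \<noteq> 0 \<and> y q = c *s \<theta> (p + q)"
    "\<And>q. q \<in> S \<inter> forms d \<Longrightarrow> y q \<noteq> 0"
    "y 0 = v"
    "\<And>f k. f \<in> func_algebra (S \<inter> forms d) (shifted_coeffs d p \<union> range (\<lambda>i q. y q $ i)) \<Longrightarrow>
       C_k_on k (forms d) (S \<inter> forms d) f"
proof -
  define J :: "('n \<Rightarrow>\<^sub>0 nat) set" where "J = {\<beta>. mdeg \<beta> = d - 1}"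
  define c where "c = veronese_gram_scale d v"
  have c: "c > 0" unfolding c_def by (rule veronese_gram_scale_pos[OF v])
  define a where "a = dual_covector v"
  have av: "covector a v = 1" unfolding a_def by (rule covector_dual_self[OF v])
  define B where "B q = (\<chi> i j. gram_matrix J (hankel d (p + q)) $ i $ j / complex_of_real c)" for q
  define y where "y q = (1 / covector a (\<theta> (p + q))) *s \<theta> (p + q)" for q
  define e where "e q = (\<Sum>i\<in>UNIV. \<Sum>j\<in>UNIV. cmod (B q $ i $ j - B 0 $ i $ j))" for q
  \<comment> \<open>Unlike \<open>at 0 within forms d\<close>, this filter includes the point \<open>0\<close>; the neighbourhood found with its
    help must contain \<open>0\<close>.\<close>
  define W where "W = inf (nhds (0 :: 'n cpoly)) (principal (forms d))"
  have p_forms: "p \<in> forms d" unfolding p by (rule veronese_map_forms)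

  have B_alg: "(\<lambda>q. B q $ i $ j) \<in> func_algebra U G" if "shifted_coeffs d p \<subseteq> G" for i j U G
    unfolding B_def J_def vec_lambda_beta
    by (intro func_algebra_divide func_algebra.const gram_matrix_in_func_algebra[OF d that])
      (use c in auto)
  have B_diff: "differentiates_into T U (func_algebra U G) (\<lambda>q. B q $ i $ j)"
    if "shifted_coeffs d p \<subseteq> G" for i j T U G
    using func_algebra_differentiates[OF shifted_coeffs_differentiate[OF _ that] B_alg[OF order_refl]]
    by blast
  have B0: "B 0 $ i $ j = v $ i * a j" for i j
    using c gram_matrix_veronese_map[OF d v, of i j]
    by (simp add: B_def J_def a_def c_def p)
  have W_nhds: "(f \<longlongrightarrow> L) W" if "(f \<longlongrightarrow> L) (nhds 0)" for f :: "'n cpoly \<Rightarrow> 'z::topological_space" and L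
    using that unfolding W_def by (rule filterlim_mono) simp_all
  have B_lim: "((\<lambda>q. B q $ i $ j) \<longlongrightarrow> B 0 $ i $ j) W" for i j
    by (rule W_nhds[OF func_algebra_shifted_coeffs_tendsto[OF B_alg[OF order_refl]]])

  have top: "norm (\<theta> (p + q)) = 1 \<and> (\<exists>\<mu>. B q *v \<theta> (p + q) = complex_of_real \<mu> *s \<theta> (p + q) \<and>
      (\<forall>z. inner (B q *v z) z \<le> \<mu> * (norm z)\<^sup>2))" if q: "q \<in> forms d" for q
  proof -
    obtain \<mu> where u: "norm (\<theta> (p + q)) = 1"
      and eig: "gram_matrix J (hankel d (p + q)) *v \<theta> (p + q) = complex_of_real \<mu> *s \<theta> (p + q)"
      and dom: "\<And>z. inner (gram_matrix J (hankel d (p + q)) *v z) z \<le> \<mu> * (norm z)\<^sup>2"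
      using first_left_singular_vector_dominates[OF \<theta>[OF forms_add[OF p_forms q]], folded J_def]
      by metis
    have B: "B q *v z = (1 / c) *\<^sub>R (gram_matrix J (hankel d (p + q)) *v z)" for z
      by (simp add: B_def vec_eq_iff matrix_vector_mult_def sum_distrib_left
          scaleR_conv_of_real[where 'a = complex] divide_inverse mult_ac)
    have "B q *v \<theta> (p + q) = complex_of_real (\<mu> / c) *s \<theta> (p + q)"
      unfolding B eig by (simp add: vec_eq_iff scaleR_conv_of_real[where 'a = complex])
    moreover have "inner (B q *v z) z \<le> \<mu> / c * (norm z)\<^sup>2" for z
      using dom[of z] c unfolding B by (simp add: divide_right_mono)
    ultimately show ?thesis using u by blast
  qed

  have e_lim: "(e \<longlongrightarrow> 0) W"
  proof -
    have "(e \<longlongrightarrow> (\<Sum>i\<in>(UNIV::'n set). \<Sum>j\<in>(UNIV::'n set). cmod (B 0 $ i $ j - B 0 $ i $ j))) W"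
      unfolding e_def
      by (intro tendsto_sum tendsto_norm tendsto_diff tendsto_const B_lim)
    then show ?thesis by simp
  qed
  have W_forms: "\<forall>\<^sub>F q in W. q \<in> forms d"
    by (simp add: W_def eventually_inf_principal)
  have e_small: "\<forall>\<^sub>F q in W. e q < 1 / 2"
    by (rule order_tendstoD(2)[OF e_lim]) simp
  have near: "covector a (\<theta> (p + q)) \<noteq> 0 \<and> (norm (y q - v))\<^sup>2 \<le> (norm v)\<^sup>2 * (2 * e q / (1 - 2 * e q))"
    if q: "q \<in> forms d" "e q < 1 / 2" for q
  proof -
    obtain \<mu> where \<mu>: "norm (\<theta> (p + q)) = 1" "B q *v \<theta> (p + q) = complex_of_real \<mu> *s \<theta> (p + q)"
      "\<And>z. inner (B q *v z) z \<le> \<mu> * (norm z)\<^sup>2"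
      using top[OF q(1)] by blast
    have B0': "B 0 $ i $ j = v $ i * dual_covector v j" for i j
      by (simp add: B0 a_def)
    show ?thesis
      unfolding a_def y_def
      using dominant_eigenvector_near_rank_one[OF v B0' \<mu> e_def q(2)] by blast
  qed
  have y_lim: "((\<lambda>q. y q $ i) \<longlongrightarrow> v $ i) W" for i
  proof -
    have "((\<lambda>q. (norm v)\<^sup>2 * (2 * e q / (1 - 2 * e q))) \<longlongrightarrow> (norm v)\<^sup>2 * (2 * 0 / (1 - 2 * 0))) W"
      by (intro tendsto_mult tendsto_divide tendsto_diff tendsto_const e_lim) simp
    then have "((\<lambda>q. (norm v)\<^sup>2 * (2 * e q / (1 - 2 * e q))) \<longlongrightarrow> 0) W" by simp
    then have "((\<lambda>q. (norm (y q - v))\<^sup>2) \<longlongrightarrow> 0) W"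
    proof (rule Lim_null_comparison[rotated])
      show "\<forall>\<^sub>F q in W. norm ((norm (y q - v))\<^sup>2) \<le> (norm v)\<^sup>2 * (2 * e q / (1 - 2 * e q))"
        using W_forms e_small by eventually_elim (use near in simp)
    qed
    then have "((\<lambda>q. sqrt ((norm (y q - v))\<^sup>2)) \<longlongrightarrow> sqrt 0) W"
      by (rule tendsto_real_sqrt)
    then have "((\<lambda>q. norm (y q - v)) \<longlongrightarrow> 0) W" by simp
    then have "(y \<longlongrightarrow> v) W"
      by (simp only: tendsto_norm_zero_iff flip: Lim_null)
    then show ?thesis by (rule tendsto_vec_nth)
  qed

  obtain P C where P: "eventually P W"
    and det: "\<And>x x'. P x \<Longrightarrow> P x' \<Longrightarrow> det (eig_matrix a (B x') (y x) (y x')) \<noteq> 0"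
    and bound: "\<And>x x' k j l. P x \<Longrightarrow> P x' \<Longrightarrow> cmod (eig_coeff a (B x') (y x) (y x') k j l) \<le> C"
    using eventually_eig_matrix_regular[OF B_lim[unfolded B0] y_lim av] by metis
  have "\<forall>\<^sub>F q in nhds 0. q \<in> forms d \<longrightarrow> P q \<and> e q < 1 / 2"
    using eventually_conj[OF P e_small] unfolding W_def by (simp add: eventually_inf_principal)
  then obtain S where S: "open S" "0 \<in> S" and SP: "\<And>q. q \<in> S \<inter> forms d \<Longrightarrow> P q \<and> e q < 1 / 2"
    unfolding eventually_nhds by blast
  define U where "U = S \<inter> forms d"
  define G where "G = shifted_coeffs d p \<union> range (\<lambda>i q. y q $ i)"

  have norml: "covector a (\<theta> (p + q)) \<noteq> 0" if "q \<in> U" for q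
    using near SP that unfolding U_def by blast
  have ay: "covector a (y q) = 1" if "q \<in> U" for q
    using norml[OF that] by (simp add: y_def covector_scale)
  have eig: "B q *v y q = covector a (B q *v y q) *s y q" if "q \<in> U" for q
  proof -
    obtain \<mu> where "B q *v \<theta> (p + q) = complex_of_real \<mu> *s \<theta> (p + q)"
      using top \<open>q \<in> U\<close> unfolding U_def by blast
    then have "B q *v y q = complex_of_real \<mu> *s y q"
      unfolding y_def vector_scalar_commute by (simp add: vector_smult_assoc mult.commute)
    then show ?thesis by (simp add: covector_scale ay[OF that])
  qed
  have "differentiates_into (forms d) U (func_algebra U G) (\<lambda>q. y q $ k)" for k
  proof (rule eigenvector_differentiates_into[OF eig])
    show "(\<lambda>q. B q $ j $ l) \<in> func_algebra U G" for j l
      by (rule B_alg) (simp add: G_def)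
    show "differentiates_into (forms d) U (func_algebra U G) (\<lambda>q. B q $ j $ l)" for j l
      by (rule B_diff) (simp add: G_def)
    show "det (eig_matrix a (B x') (y x) (y x')) \<noteq> 0" if "x \<in> U" "x' \<in> U" for x x'
      using det SP that unfolding U_def by blast
    show "cmod (eig_coeff a (B x') (y x) (y x') k j l) \<le> C" if "x \<in> U" "x' \<in> U" for x x' k j l
      using bound SP that unfolding U_def by blast
    show "(\<lambda>q. y q $ i) \<in> G" for i by (auto simp: G_def)
  qed
  then have gen: "g \<in> func_algebra U G \<and> differentiates_into (forms d) U (func_algebra U G) g" if "g \<in> G" for g
    using that shifted_coeffs_differentiate[of g d p G U "forms d"]
    by (auto simp: G_def intro: func_algebra.gen)
  have "differentiates_into (forms d) U (func_algebra U G) f" if "f \<in> func_algebra U G" for f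
    using func_algebra_differentiates[OF gen that] by blast
  then have smooth: "C_k_on k (forms d) U f" if "f \<in> func_algebra U G" for f k
    using that by (rule C_k_on_if_closed_under_derivatives)

  have zero: "0 \<in> U" using S(2) by (simp add: U_def forms_def)
  \<comment> \<open>At \<open>q = 0\<close> the singular vector is a multiple of \<open>v\<close>, and \<open>\<ell>(v) = 1\<close> fixes the multiple.\<close>
  obtain b where "\<theta> p = b *s v"
    using first_left_singular_vector_veronese_map[OF d v] \<theta>[OF p_forms] unfolding p by metis
  then have "y 0 = v"
    using norml[OF zero] av by (simp add: y_def covector_scale vector_smult_assoc)
  moreover have "y q \<noteq> 0" if "q \<in> U" for q
    using ay[OF that] by (auto simp: covector_def)
  moreover have "\<exists>c. c \<noteq> 0 \<and> y q = c *s \<theta> (p + q)" if "q \<in> U" for q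
    using norml[OF that] unfolding y_def by (intro exI[of _ "1 / covector a (\<theta> (p + q))"]) simp
  ultimately show thesis
    using S smooth unfolding U_def G_def by (intro that[of S y]) auto
qed

text \<open>
  The map to be shown a retraction is the identity on the Veronese manifold; together with
  smoothness this determines its value and its derivative at \<open>p\<close>.
\<close>

lemma rank_one_approximation_fixes_veronese:
  assumes "d > 0" "w \<noteq> 0"
    "first_left_singular_vector {\<beta>. mdeg \<beta> = d - 1} (hankel d (veronese_map d w)) u"
  shows "veronese_proj d u (veronese_map d w) = veronese_map d w"
proof -
  obtain c where "c \<noteq> 0" "u = c *s w"
    by (rule first_left_singular_vector_veronese_map[OF assms])
  then show ?thesis by (simp add: veronese_proj_scale veronese_proj_self assms(2))
qed

section \<open>The retraction\<close>

text \<open>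
  By the binomial theorem the curve is a polynomial in \<open>t\<close>. The factor \<open>1 / d\<close> cancels the binomial
  coefficient of the linear term, so each tangent vector is the velocity of such a curve.
\<close>

lemma veronese_curve_has_vector_derivative:
  assumes "d > 0"
  shows "((\<lambda>t. veronese_map d (w + (complex_of_real t / of_nat d) *s u)) has_vector_derivative
    linear_form u * linear_form w ^ (d - 1)) (at 0)"
proof -
  define X where "X k = of_nat (d choose k) * linear_form u ^ k * linear_form w ^ (d - k)" for k
  have curve: "veronese_map d (w + (complex_of_real t / of_nat d) *s u) = (\<Sum>k\<le>d. (t / d) ^ k *\<^sub>R X k)" for t
  proof -
    have "of_nat (d choose k) * (Poly_Mapping.single 0 (complex_of_real t / of_nat d) * linear_form u) ^ k *
        linear_form w ^ (d - k) = (t / d) ^ k *\<^sub>R X k" for k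
      by (simp add: X_def power_mult_distrib const_power mult_ac flip: const_mult_eq_scaleR)
    then show ?thesis
      unfolding veronese_map_def linear_form_add linear_form_scale
      by (subst add.commute) (simp add: binomial_ring)
  qed
  have "((\<lambda>t::real. \<Sum>k\<le>d. (t / d) ^ k *\<^sub>R X k) has_vector_derivative
      (\<Sum>k\<le>d. (of_nat k * (0 / d) ^ (k - 1) * (1 / d)) *\<^sub>R X k)) (at 0)"
  proof (rule has_vector_derivative_sum)
    fix k
    have "((\<lambda>t::real. (t / d) ^ k) has_real_derivative of_nat k * (0 / d) ^ (k - 1) * (1 / d)) (at 0)"
      using assms by (auto intro!: derivative_eq_intros)
    from has_vector_derivative_scaleR[OF this has_vector_derivative_const[of "X k"]]
    show "((\<lambda>t::real. (t / d) ^ k *\<^sub>R X k) has_vector_derivative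
        (of_nat k * (0 / d) ^ (k - 1) * (1 / d)) *\<^sub>R X k) (at 0)" by simp
  qed
  moreover have "(\<Sum>k\<le>d. (of_nat k * (0 / d) ^ (k - 1) * (1 / d)) *\<^sub>R X k) = linear_form u * linear_form w ^ (d - 1)"
  proof -
    have "(\<Sum>k\<le>d. (of_nat k * (0 / d) ^ (k - 1) * (1 / d)) *\<^sub>R X k) = (\<Sum>k\<le>d. if k = 1 then (1 / d) *\<^sub>R X 1 else 0)"
      by (rule sum.cong) (auto simp: power_0_left)
    also have "\<dots> = (1 / d) *\<^sub>R X 1" using assms by simp
    also have "\<dots> = linear_form u * linear_form w ^ (d - 1)"
    proof -
      have "Poly_Mapping.single 0 (complex_of_real (1 / d)) * X 1 =
          (Poly_Mapping.single 0 (complex_of_real (1 / d)) * Poly_Mapping.single 0 (of_nat d)) *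
          (linear_form u * linear_form w ^ (d - 1))"
        by (simp add: X_def single_of_nat mult_ac)
      also have "Poly_Mapping.single 0 (complex_of_real (1 / d)) * Poly_Mapping.single 0 (of_nat d) = (1 :: 'a cpoly)"
        using assms by (simp add: mult_single del: single_of_nat)
      finally show ?thesis unfolding const_mult_eq_scaleR by simp
    qed
    finally show ?thesis .
  qed
  ultimately show ?thesis by (simp only: curve)
qed

theorem proposition4p15:
  fixes d :: nat and p :: "('n::finite) cpoly" and \<theta> :: "'n cpoly \<Rightarrow> complex ^ 'n"
  assumes "d > 2"
    and "p \<in> veronese d"
    and "\<And>f. f \<in> forms d \<Longrightarrow>
           first_left_singular_vector {\<beta>. mdeg \<beta> = d - 1} (hankel d f) (\<theta> f)"
  shows "retraction_at (veronese d) (veronese_tangent d p) p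
           (\<lambda>q. veronese_proj d (\<theta> (p + q)) (p + q))"
proof -
  define R where "R q = veronese_proj d (\<theta> (p + q)) (p + q)" for q
  define T where "T = veronese_tangent d p"
  have d: "d > 0" using assms(1) by simp
  have TF: "T \<subseteq> forms d" unfolding T_def by (rule veronese_tangent_subset_forms[OF d])
  from assms(2) obtain v where v: "v \<noteq> 0" and p: "p = veronese_map d v"
    by (auto simp: veronese_def)
  have p_forms: "p \<in> forms d" unfolding p by (rule veronese_map_forms)
  have R_fix: "R (veronese_map d w - p) = veronese_map d w" if "w \<noteq> 0" for w
    unfolding R_def using rank_one_approximation_fixes_veronese[OF d that assms(3)[OF veronese_map_forms]]
    by simp
  have R0: "R 0 = p" using R_fix[OF v] by (simp add: p)

  obtain S y where S: "open S" "0 \<in> S"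
    and scale: "\<And>q. q \<in> S \<inter> forms d \<Longrightarrow> \<exists>c. c \<noteq> 0 \<and> y q = c *s \<theta> (p + q)"
    and y0: "\<And>q. q \<in> S \<inter> forms d \<Longrightarrow> y q \<noteq> 0" and yv: "y 0 = v"
    and smooth: "\<And>f k. f \<in> func_algebra (S \<inter> forms d) (shifted_coeffs d p \<union> range (\<lambda>i q. y q $ i)) \<Longrightarrow>
       C_k_on k (forms d) (S \<inter> forms d) f"
    by (rule smooth_top_eigenvector[OF d v p assms(3)]) (assumption | rule that)+
  define U where "U = S \<inter> forms d"
  define G where "G = shifted_coeffs d p \<union> range (\<lambda>i q. y q $ i)"
  define N where "N q = apolar d (veronese_map d (y q)) (p + q)" for q
  define s where "s q = N q / apolar d (veronese_map d (y q)) (veronese_map d (y q))" for q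
  have zero: "0 \<in> U" using S(2) by (simp add: U_def forms_def)

  have coeff: "(\<lambda>q. ncoeff d (p + q) \<alpha>) \<in> func_algebra U G" for \<alpha>
    by (rule func_algebra.gen) (auto simp: G_def shifted_coeffs_def)
  have vp: "(\<lambda>q. vpow (y q) \<alpha>) \<in> func_algebra U G" for \<alpha>
    unfolding vpow_def
    by (intro func_algebra_prod func_algebra_power func_algebra.gen) (auto simp: G_def)
  have N_alg: "N \<in> func_algebra U G"
    unfolding N_def apolar_veronese_map
    by (intro func_algebra_sum func_algebra.mult func_algebra.const func_algebra.cnj vp coeff)
  have "(\<lambda>q. \<Sum>\<alpha> | mdeg \<alpha> = d. multinomial d \<alpha> * cnj (vpow (y q) \<alpha>) * vpow (y q) \<alpha>) \<in> func_algebra U G"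
    by (intro func_algebra_sum func_algebra.mult func_algebra.const func_algebra.cnj vp)
  also have "(\<lambda>q. \<Sum>\<alpha> | mdeg \<alpha> = d. multinomial d \<alpha> * cnj (vpow (y q) \<alpha>) * vpow (y q) \<alpha>) =
      (\<lambda>q. apolar d (veronese_map d (y q)) (veronese_map d (y q)))"
    unfolding apolar_veronese_map by (intro ext sum.cong refl) (simp add: ncoeff_veronese_map)
  finally have s_alg: "s \<in> func_algebra U G"
    unfolding s_def
    by (intro func_algebra_divide N_alg) (use y0 in \<open>auto simp: U_def apolar_veronese_map_self_nonzero\<close>)

  have R_y: "R q = veronese_proj d (y q) (p + q)" if "q \<in> U" for q
    using scale that veronese_proj_scale[of _ d "\<theta> (p + q)" "p + q"] unfolding U_def R_def by metis
  have R_sum: "(\<Sum>\<alpha> | mdeg \<alpha> = d. Poly_Mapping.single \<alpha> (s q * (multinomial d \<alpha> * vpow (y q) \<alpha>))) = R q"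
    if "q \<in> U" for q
  proof -
    have "R q = Poly_Mapping.single 0 (s q) * veronese_map d (y q)"
      unfolding R_y[OF that] veronese_proj_eq s_def N_def ..
    also have "\<dots> = (\<Sum>\<alpha> | mdeg \<alpha> = d. Poly_Mapping.single \<alpha> (s q * (multinomial d \<alpha> * vpow (y q) \<alpha>)))"
      by (simp add: veronese_map_eq_sum sum_distrib_left mult_single)
    finally show ?thesis ..
  qed
  have smoothU: "C_k_on k (forms d) U f" if "f \<in> func_algebra U G" for f k
    using smooth that unfolding U_def G_def by blast
  have "C_k_on k (forms d) U (\<lambda>q. \<Sum>\<alpha> | mdeg \<alpha> = d.
      Poly_Mapping.single \<alpha> (s q * (multinomial d \<alpha> * vpow (y q) \<alpha>)))" for k
    by (rule C_k_on_sum_bounded_linear[OF bounded_linear_single])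
      (intro smoothU func_algebra.mult func_algebra.const s_alg vp)
  then have R_smooth: "C_k_on k (forms d) U R" for k
    using R_sum by (rule C_k_on_cong[rotated])

  \<comment> \<open>Where the apolar product with \<open>\<psi>(y)\<close> vanishes, the projection is the zero polynomial, which is not in
    the Veronese manifold.\<close>
  define V where "V = {q \<in> U. N q \<noteq> 0}"
  have openV: "openin (top_of_set (forms d)) V"
  proof -
    have "continuous_on U N" using smoothU[OF N_alg, of 0] by simp
    then have "openin (top_of_set U) (U \<inter> N -` (- {0}))"
      by (rule continuous_openin_preimage_gen) (rule open_Compl[OF closed_singleton])
    moreover have "openin (top_of_set (forms d)) U"
      unfolding U_def by (subst Int_commute) (rule openin_open_Int[OF S(1)])
    moreover have "U \<inter> N -` (- {0}) = V" by (auto simp: V_def)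
    ultimately show ?thesis by (metis openin_trans)
  qed
  have zeroV: "0 \<in> V"
    using zero v by (simp add: V_def N_def yv p apolar_veronese_map_self_nonzero)
  have R_veronese: "R q \<in> veronese d" if "q \<in> V" for q
    using that y0 unfolding V_def U_def N_def
    by (auto simp: R_y U_def intro: veronese_proj_in_veronese[OF d])

  from R_smooth[of 1] obtain D where "(R has_derivative D) (at 0 within U)"
    using zero by auto
  moreover have "at 0 within U = at 0 within forms d"
    by (rule at_within_nhd[OF S(2,1)]) (auto simp: U_def)
  ultimately have D: "(R has_derivative D) (at 0 within forms d)" by simp

  have D_id: "D h = h" if "h \<in> T" for h
  proof -
    from that obtain u w where w: "w \<noteq> 0" "veronese_map d w = p"
      and h: "h = linear_form u * linear_form w ^ (d - 1)"
      unfolding T_def veronese_tangent_def by blast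
    define x where "x t = w + (complex_of_real t / of_nat d) *s u" for t
    define g where "g t = veronese_map d (x t) - p" for t
    have "g 0 = 0" by (simp add: g_def x_def w)
    have "((\<lambda>t. veronese_map d (x t)) has_vector_derivative h) (at 0)"
      unfolding h x_def by (rule veronese_curve_has_vector_derivative[OF d])
    from has_vector_derivative_diff[OF this has_vector_derivative_const[of p]]
    have g': "(g has_derivative (\<lambda>t. t *\<^sub>R h)) (at 0)"
      by (simp add: g_def[abs_def] has_vector_derivative_def)
    have "range g \<subseteq> forms d"
      using forms_add[OF veronese_map_forms forms_uminus[OF p_forms]] by (auto simp: g_def)
    with D have "(R has_derivative D) (at (g 0) within range g)"
      unfolding \<open>g 0 = 0\<close> by (rule has_derivative_subset)
    with g' have Rg: "((\<lambda>t. R (g t)) has_derivative (\<lambda>t. D (t *\<^sub>R h))) (at 0)"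
      by (rule has_derivative_in_compose)
    have "((\<lambda>t. p + g t) has_derivative (\<lambda>t. t *\<^sub>R h)) (at 0)"
      using has_derivative_add[OF has_derivative_const g'] by simp
    moreover have "\<forall>\<^sub>F t in at 0. p + g t = R (g t)"
    proof -
      have "isCont x 0"
        unfolding x_def isCont_def by (rule vec_tendstoI) (use d in \<open>auto intro!: tendsto_eq_intros\<close>)
      then have "\<forall>\<^sub>F t in at 0. x t \<noteq> 0"
        unfolding isCont_def by (rule tendsto_imp_eventually_ne) (simp add: x_def w)
      then show ?thesis
        by (rule eventually_mono) (simp add: g_def R_fix)
    qed
    moreover have "p + g 0 = R (g 0)" by (simp add: \<open>g 0 = 0\<close> R0)
    ultimately have "((\<lambda>t. R (g t)) has_derivative (\<lambda>t. t *\<^sub>R h)) (at 0)"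
      by (rule has_derivative_transform_eventually[of _ _ 0 UNIV, simplified])
    from has_derivative_unique[OF Rg this] show ?thesis by (metis scaleR_one)
  qed
  have "(R has_derivative D) (at 0 within T)"
    using D TF by (rule has_derivative_subset)
  \<comment> \<open>The linear map \<open>D\<close> is only known on \<open>T\<close>. The difference quotients within \<open>T\<close> see nothing else, so
    \<open>D\<close> may be exchanged for the identity.\<close>
  then have "((\<lambda>q. (1 / norm (q - 0)) *\<^sub>R (R q - (R 0 + D (q - 0)))) \<longlongrightarrow> 0) (at 0 within T)"
    unfolding has_derivative_within by blast
  then have "((\<lambda>q. (1 / norm (q - 0)) *\<^sub>R (R q - (R 0 + (q - 0)))) \<longlongrightarrow> 0) (at 0 within T)"
    by (rule Lim_transform_eventually) (auto simp: eventually_at_filter D_id)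
  then have R_id: "(R has_derivative (\<lambda>q. q)) (at 0 within T)"
    unfolding has_derivative_within using bounded_linear_ident by blast

  have "openin (top_of_set T) (V \<inter> T)"
  proof -
    obtain O' where "open O'" "V = forms d \<inter> O'"
      using openV unfolding openin_open by blast
    moreover from this have "V \<inter> T = T \<inter> O'" using TF by blast
    ultimately show ?thesis using openin_open_Int by simp
  qed
  moreover have "0 \<in> T"
  proof -
    have "linear_form 0 * linear_form v ^ (d - 1) = 0" by (simp add: linear_form_def)
    then show ?thesis
      unfolding T_def veronese_tangent_def mem_Collect_eq
      by (intro exI[of _ 0] exI[of _ v]) (simp add: v p)
  qed
  moreover have "smooth_on T (V \<inter> T) R"
    unfolding smooth_on_def
  proof
    fix k
    show "C_k_on k T (V \<inter> T) R"
      using R_smooth TF by (rule C_k_on_subset) (auto simp: V_def)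
  qed
  moreover have "R ` (V \<inter> T) \<subseteq> veronese d" using R_veronese by blast
  moreover have "0 \<in> V \<inter> T" using zeroV \<open>0 \<in> T\<close> by blast
  ultimately have "retraction_at (veronese d) T p R"
    unfolding retraction_at_def using R0 R_id by blast
  then show ?thesis unfolding R_def T_def .
qed

end
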